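(* Fix positive integers $p,q,k$ with $p\le q$ and $k\ge 3$. Then $$\operatorname{diam}\mathcal{C}_k(K_{p,q})= \begin{cases} 2p+q+\left\lfloor\frac{q-p}{k-1}\right\rfloor & \text{if } q\ge kp,\\[2mm] 3p+q+\left\lfloor\frac{q-kp}{\lfloor k^2/4\rfloor}\right\rfloor-g_1(k,p,q) & \text{if } \lceil k/2\rceil\, p\le q\le kp,\\[2mm] 2p+q+\left\lfloor\frac{q-p}{\lceil k/2\rceil}\right\rfloor-g_2(k,p,q) & \text{if } q\le \lceil k/2\rceil\, p, \end{cases}$$ where $g_1(k,p,q)$ and $g_2(k,p,q)$ are quantities satisfying $0\le g_1(k,p,q)\le \lfloor k^2/4\rfloor$ and $0\le g_2(k,p,q)\le \lfloor k/2\rfloor$.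
   Context: $K_{p,q}$ is the complete bipartite graph with parts of sizes $p$ and $q$. For a graph $G$, a $k$-colouring is a proper vertex colouring with colours from $[k]=\{1,\dots,k\}$ (not all colours need be used). The $k$-recolouring graph $\mathcal{C}_k(G)$ has as vertices the $k$-colourings of $G$; two $k$-colourings are adjacent precisely when they differ in the colour of exactly one vertex of $G$. $\operatorname{diam}\mathcal{C}_k(G)$ is the maximum over all pairs of $k$-colourings $\alpha,\beta$ of the distance from $\alpha$ to $\beta$ in $\mathcal{C}_k(G)$. *)

theory Defs
  imports "Graph_Theory.Graph_Theory"
begin

text \<open>Graphs are symmetric digraphs, as in \<^theory>\<open>Graph_Theory.Digraph\<close>.\<close>

text \<open>Colourings are extensional functions (undefined off the vertex set), so that distinct
  functions are distinct colourings.\<close>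

definition colourings :: "nat \<Rightarrow> ('a, 'b) pre_digraph \<Rightarrow> ('a \<Rightarrow> nat) set" where
  "colourings k G = {c \<in> verts G \<rightarrow>\<^sub>E {1..k}. \<forall>(u, v) \<in> arcs_ends G. c u \<noteq> c v}"

definition recolouring_graph :: "nat \<Rightarrow> ('a, 'b) pre_digraph \<Rightarrow> ('a \<Rightarrow> nat) pair_pre_digraph" where
  "recolouring_graph k G =
     \<lparr> pverts = colourings k G,
       parcs = {(\<alpha>, \<beta>) \<in> colourings k G \<times> colourings k G. \<exists>!v. v \<in> verts G \<and> \<alpha> v \<noteq> \<beta> v} \<rparr>"

lemma wf_recolouring_graph: "wf_digraph (with_proj (recolouring_graph k G))"
  by unfold_locales (auto simp: recolouring_graph_def)

text \<open>With unit arc weights, \<open>\<mu>\<close> is the usual graph distance, with value \<open>\<infinity>\<close> on pairs not joined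
  by a walk. The supremum is therefore finite only if the graph is strongly connected, and it is
  a maximum for finite nonempty graphs.\<close>

definition (in wf_digraph) diameter :: ereal where
  "diameter = (SUP u \<in> verts G. SUP v \<in> verts G. \<mu> (\<lambda>_. 1) u v)"

end

theory Submission
  imports Defs
begin

text \<open>
  Let \<open>A\<close> and \<open>B\<close> be the parts of sizes \<open>p\<close> and \<open>q\<close>.

  Upper bound. To go from \<open>\<alpha>\<close> to \<open>\<beta>\<close>, either give all of \<open>A\<close> one intermediate colour \<open>e\<close> (a hub),
  or move \<open>A\<close> through a colour \<open>c\<close> unused by \<open>\<alpha>\<close> on \<open>B\<close> and then a colour \<open>d\<close> unused by \<open>\<beta>\<close> on \<open>B\<close>
  (a relay). A vertex of \<open>B\<close> costs extra moves only for the few choices that interfere with its own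
  pair of colours, so averaging over all hubs and relays yields a cheap one.

  Lower bound. Split the colours into \<open>C\<close> and \<open>D\<close>, let \<open>A\<close> go from \<open>C\<close> to \<open>D\<close> and \<open>B\<close> from \<open>D\<close> to
  \<open>C\<close>. The colours of \<open>A\<close> around the first time it uses \<open>D\<close> and the last time it uses \<open>C\<close>
  force detours, whose number is controlled by how many vertices change from each \<open>c\<close> to each \<open>d\<close>.
  Spreading the vertices evenly over the pairs, with \<open>|C|\<close> and \<open>|D|\<close> as equal as possible (or
  \<open>|C| = 1\<close> if \<open>q \<ge> k p\<close>), makes every strategy expensive.
\<close>

section \<open>Distances in the recolouring graph\<close>

text \<open>If every path were longer than 2p + q + t, summing over the |R| hubs in \<open>R\<close>
  and the |C||D| relays would give k p + N (t + 1 - p) \<le> q with N = |R| + |C||D|. Only N depends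
  on the colourings, and it lies between k - 1 and floor(k^2/4). The sign of t + 1 - p, in effect
  whether q exceeds k p, decides which extreme is the worst; this is the origin of the first two
  denominators. A relay recolours \<open>A\<close> up to three times, a hub at most twice, so for
  small q hubs alone are better: at least ceil(k/2) colours lie outside the smaller of
  \<open>C\<close> and \<open>D\<close>, whence the third denominator. These upper bounds are
  already the main terms. The corrections g1 and g2 come from the lower bound alone, where p and q -
  p need not divide evenly among the colour pairs.\<close>

definition cols :: "nat \<Rightarrow> 'v set \<Rightarrow> 'v set \<Rightarrow> ('v \<Rightarrow> nat) set" where
  "cols k A B = {f \<in> (A \<union> B) \<rightarrow>\<^sub>E {1..k}. \<forall>a\<in>A. \<forall>b\<in>B. f a \<noteq> f b}"

definition steps :: "nat \<Rightarrow> 'v set \<Rightarrow> 'v set \<Rightarrow> (('v \<Rightarrow> nat) \<times> ('v \<Rightarrow> nat)) set" where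
  "steps k A B = {(f, g) \<in> cols k A B \<times> cols k A B. \<exists>!v. v \<in> A \<union> B \<and> f v \<noteq> g v}"

definition reach :: "nat \<Rightarrow> 'v set \<Rightarrow> 'v set \<Rightarrow> nat \<Rightarrow> ('v \<Rightarrow> nat) \<Rightarrow> ('v \<Rightarrow> nat) \<Rightarrow> bool" where
  "reach k A B n f g \<longleftrightarrow> (\<exists>m\<le>n. (f, g) \<in> steps k A B ^^ m)"

text \<open>A predicate rather than a number, so that bounds can be proved and transported before
  the maximum is known to be finite.\<close>

definition diam_le :: "nat \<Rightarrow> 'v set \<Rightarrow> 'v set \<Rightarrow> nat \<Rightarrow> bool" where
  "diam_le k A B n \<longleftrightarrow> (\<forall>f\<in>cols k A B. \<forall>g\<in>cols k A B. reach k A B n f g)"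

lemma card_eq_sum_of_bool: "finite A \<Longrightarrow> card {v \<in> A. P v} = (\<Sum>v\<in>A. of_bool (P v))"
  by (simp add: Collect_conj_eq Int_commute)

lemma reach_refl: "reach k A B n f f"
  unfolding reach_def by (rule exI[of _ 0]) simp

lemma reach_trans:
  assumes "reach k A B m f g" "reach k A B n g h"
  shows "reach k A B (m + n) f h"
proof -
  obtain i where i: "i \<le> m" "(f, g) \<in> steps k A B ^^ i"
    using assms(1) unfolding reach_def by blast
  obtain j where j: "j \<le> n" "(g, h) \<in> steps k A B ^^ j"
    using assms(2) unfolding reach_def by blast
  have "(f, h) \<in> steps k A B ^^ (i + j)"
    using i j by (auto simp: relpow_add)
  then show ?thesis
    unfolding reach_def using i(1) j(1) by (intro exI[of _ "i + j"]) auto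
qed

lemma reach_mono: "reach k A B m f g \<Longrightarrow> m \<le> n \<Longrightarrow> reach k A B n f g"
  unfolding reach_def by (meson order_trans)

lemma steps_sym: "(f, g) \<in> steps k A B \<Longrightarrow> (g, f) \<in> steps k A B"
  unfolding steps_def by (auto simp: eq_commute)

lemma reach_sym:
  assumes "reach k A B n f g" shows "reach k A B n g f"
proof -
  have "(g, f) \<in> steps k A B ^^ m" if "(f, g) \<in> steps k A B ^^ m" for m
    using that
  proof (induction m arbitrary: f g)
    case (Suc m)
    then obtain h where "(f, h) \<in> steps k A B ^^ m" "(h, g) \<in> steps k A B" by auto
    then have "(h, f) \<in> steps k A B ^^ m" "(g, h) \<in> steps k A B"
      using Suc.IH steps_sym by blast+
    then show ?case by (rule relpow_Suc_I2[rotated])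
  qed simp
  then show ?thesis using assms unfolding reach_def by blast
qed

lemma wf_digraph_with_proj:
  assumes "E \<subseteq> V \<times> V"
  shows "wf_digraph (with_proj \<lparr>pverts = V, parcs = E\<rparr>)"
  using assms by unfold_locales auto

text \<open>The paths below are relation powers, whereas \<open>\<mu>\<close> is an infimum over arc
  walks; this is the dictionary between the two.\<close>

lemma relpow_iff_awalk:
  assumes "E \<subseteq> V \<times> V" "u \<in> V"
  defines "H \<equiv> with_proj \<lparr>pverts = V, parcs = E\<rparr>"
  shows "(u, v) \<in> E ^^ m \<longleftrightarrow> (\<exists>es. pre_digraph.awalk H u es v \<and> length es = m)"
  using assms(2)
proof (induction m arbitrary: u)
  interpret H: wf_digraph H unfolding H_def by (rule wf_digraph_with_proj[OF assms(1)])
  case 0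
  have "verts H = V" unfolding H_def by simp
  then show ?case using 0 by (auto simp: H.awalk_Nil_iff)
next
  interpret H: wf_digraph H unfolding H_def by (rule wf_digraph_with_proj[OF assms(1)])
  case (Suc m)
  have "(u, v) \<in> E ^^ Suc m \<longleftrightarrow> (\<exists>w. (u, w) \<in> E \<and> (w, v) \<in> E ^^ m)"
    by (metis relpow_Suc_D2 relpow_Suc_I2)
  also have "\<dots> \<longleftrightarrow> (\<exists>w es. (u, w) \<in> E \<and> H.awalk w es v \<and> length es = m)"
    using Suc.IH assms(1) by blast
  also have "\<dots> \<longleftrightarrow> (\<exists>es. H.awalk u es v \<and> length es = Suc m)"
  proof
    assume "\<exists>w es. (u, w) \<in> E \<and> H.awalk w es v \<and> length es = m"
    then obtain w es where w: "(u, w) \<in> E" "H.awalk w es v" "length es = m" by blast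
    then have "H.awalk u ((u, w) # es) v"
      by (auto simp: H.awalk_Cons_iff) (auto simp: H_def)
    then show "\<exists>es. H.awalk u es v \<and> length es = Suc m"
      using w(3) by (intro exI[of _ "(u, w) # es"]) auto
  next
    assume "\<exists>es. H.awalk u es v \<and> length es = Suc m"
    then obtain e es where e: "H.awalk u (e # es) v" "length es = m"
      by (metis length_Suc_conv)
    then have "e \<in> arcs H" "tail H e = u" "H.awalk (head H e) es v"
      by (auto simp: H.awalk_Cons_iff)
    then show "\<exists>w es. (u, w) \<in> E \<and> H.awalk w es v \<and> length es = m"
      using e(2) by (intro exI[of _ "snd e"] exI[of _ es]) (auto simp: H_def)
  qed
  finally show ?case .
qed

lemma diameter_eqI:
  fixes V :: "'v set" and E :: "('v \<times> 'v) set"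
  assumes E: "E \<subseteq> V \<times> V" and "V \<noteq> {}"
    and upper: "\<And>u v. u \<in> V \<Longrightarrow> v \<in> V \<Longrightarrow> \<exists>m\<le>n. (u, v) \<in> E ^^ m"
    and lower: "\<And>n'. n' < n \<Longrightarrow> \<exists>u\<in>V. \<exists>v\<in>V. \<forall>m\<le>n'. (u, v) \<notin> E ^^ m"
  shows "wf_digraph.diameter (with_proj \<lparr>pverts = V, parcs = E\<rparr>) = ereal (real n)"
proof -
  define H where "H = with_proj \<lparr>pverts = V, parcs = E\<rparr>"
  interpret H: wf_digraph H unfolding H_def by (rule wf_digraph_with_proj[OF E])
  have verts: "verts H = V" unfolding H_def by simp
  have cost: "H.awalk_cost (\<lambda>_. 1) es = real (length es)" for es
    by (induction es) auto
  have walk: "(u, v) \<in> E ^^ m \<longleftrightarrow> (\<exists>es. H.awalk u es v \<and> length es = m)"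
    if "u \<in> V" for u v m
    using relpow_iff_awalk[OF E that] unfolding H_def by simp
  have "H.diameter \<le> ereal (real n)"
    unfolding H.diameter_def verts
  proof (intro SUP_least)
    fix u v assume "u \<in> V" "v \<in> V"
    then obtain es where "H.awalk u es v" "length es \<le> n"
      using upper walk by metis
    then have "H.\<mu> (\<lambda>_. 1) u v \<le> ereal (real (length es))"
      using H.min_cost_le_walk_cost[of u es v "\<lambda>_. 1"] cost by simp
    also have "\<dots> \<le> ereal (real n)" using \<open>length es \<le> n\<close> by simp
    finally show "H.\<mu> (\<lambda>_. 1) u v \<le> ereal (real n)" .
  qed
  moreover have "ereal (real n) \<le> H.diameter"
  proof -
    have "\<exists>u\<in>V. \<exists>v\<in>V. \<forall>m. (u, v) \<in> E ^^ m \<longrightarrow> n \<le> m"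
    proof (cases n)
      case 0
      then show ?thesis using \<open>V \<noteq> {}\<close> by blast
    next
      case (Suc n')
      then obtain u v where "u \<in> V" "v \<in> V" "\<forall>m\<le>n'. (u, v) \<notin> E ^^ m"
        using lower[of n'] by auto
      then show ?thesis using Suc by (metis not_less_eq_eq)
    qed
    then obtain u v where uv: "u \<in> V" "v \<in> V" "\<And>m. (u, v) \<in> E ^^ m \<Longrightarrow> n \<le> m" by blast
    have "ereal (real n) \<le> H.\<mu> (\<lambda>_. 1) u v"
      unfolding H.\<mu>_def
    proof (rule INF_greatest)
      fix es assume "es \<in> {es. H.awalk u es v}"
      then have "n \<le> length es" using uv walk by blast
      then show "ereal (real n) \<le> ereal (H.awalk_cost (\<lambda>_. 1) es)" using cost by simp
    qed
    also have "\<dots> \<le> H.diameter"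
      unfolding H.diameter_def verts
      using uv by (intro SUP_upper2[of u] SUP_upper2[of v]) auto
    finally show ?thesis .
  qed
  ultimately show ?thesis unfolding H_def by simp
qed

section \<open>Independence of the names of the vertices\<close>

definition pull :: "'v set \<Rightarrow> ('v \<Rightarrow> 'w) \<Rightarrow> ('w \<Rightarrow> nat) \<Rightarrow> 'v \<Rightarrow> nat" where
  "pull V \<phi> f = restrict (f \<circ> \<phi>) V"

lemma pull_cols:
  assumes "bij_betw \<phi> A A'" "bij_betw \<phi> B B'" "f \<in> cols k A' B'"
  shows "pull (A \<union> B) \<phi> f \<in> cols k A B"
proof -
  have "\<phi> v \<in> A' \<union> B'" if "v \<in> A \<union> B" for v
    using that assms(1,2) bij_betwE by blast
  moreover have "\<phi> a \<in> A'" if "a \<in> A" for a using that assms(1) bij_betwE by blast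
  moreover have "\<phi> b \<in> B'" if "b \<in> B" for b using that assms(2) bij_betwE by blast
  ultimately show ?thesis using assms(3)
    unfolding cols_def pull_def by (auto simp: PiE_iff)
qed

lemma pull_steps:
  assumes "bij_betw \<phi> A A'" "bij_betw \<phi> B B'" "bij_betw \<phi> (A \<union> B) (A' \<union> B')"
    and "(f, g) \<in> steps k A' B'"
  shows "(pull (A \<union> B) \<phi> f, pull (A \<union> B) \<phi> g) \<in> steps k A B"
proof -
  from assms(4) obtain w where w: "w \<in> A' \<union> B'" "f w \<noteq> g w"
    and w_unique: "\<And>w'. w' \<in> A' \<union> B' \<Longrightarrow> f w' \<noteq> g w' \<Longrightarrow> w' = w"
    and fg: "f \<in> cols k A' B'" "g \<in> cols k A' B'"
    unfolding steps_def by blast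
  obtain v where v: "v \<in> A \<union> B" "\<phi> v = w"
    using w(1) assms(3) by (metis bij_betw_imp_surj_on imageE)
  have "\<exists>!v. v \<in> A \<union> B \<and> pull (A \<union> B) \<phi> f v \<noteq> pull (A \<union> B) \<phi> g v"
  proof (rule ex1I[of _ v])
    show "v \<in> A \<union> B \<and> pull (A \<union> B) \<phi> f v \<noteq> pull (A \<union> B) \<phi> g v"
      using v w(2) by (simp add: pull_def)
  next
    fix v' assume v': "v' \<in> A \<union> B \<and> pull (A \<union> B) \<phi> f v' \<noteq> pull (A \<union> B) \<phi> g v'"
    then have "\<phi> v' = w"
      using w_unique[of "\<phi> v'"] bij_betwE[OF assms(3)] by (simp add: pull_def split: if_splits)
    then show "v' = v"
      using v' v bij_betw_imp_inj_on[OF assms(3)] by (metis inj_onD)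
  qed
  then show ?thesis
    using pull_cols[OF assms(1,2)] fg unfolding steps_def by auto
qed

lemma pull_relpow:
  assumes "bij_betw \<phi> A A'" "bij_betw \<phi> B B'" "bij_betw \<phi> (A \<union> B) (A' \<union> B')"
    and "(f, g) \<in> steps k A' B' ^^ m"
  shows "(pull (A \<union> B) \<phi> f, pull (A \<union> B) \<phi> g) \<in> steps k A B ^^ m"
  using assms(4)
proof (induction m arbitrary: g)
  case (Suc m)
  then obtain h where "(f, h) \<in> steps k A' B' ^^ m" "(h, g) \<in> steps k A' B'" by auto
  then show ?case
    using Suc.IH[of h] pull_steps[OF assms(1-3), of h g] relpow_Suc_I by metis
qed simp

lemma diam_le_transport:
  assumes bij: "bij_betw \<phi> A A'" "bij_betw \<phi> B B'" "bij_betw \<phi> (A \<union> B) (A' \<union> B')"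
    and le: "diam_le k A B n"
  shows "diam_le k A' B' n"
  unfolding diam_le_def
proof (intro ballI)
  fix f g assume fg: "f \<in> cols k A' B'" "g \<in> cols k A' B'"
  define \<psi> where "\<psi> = inv_into (A \<union> B) \<phi>"
  have \<psi>: "bij_betw \<psi> (A' \<union> B') (A \<union> B)"
    unfolding \<psi>_def using bij(3) by (rule bij_betw_inv_into)
  have \<psi>AB: "bij_betw \<psi> A' A" "bij_betw \<psi> B' B"
    unfolding \<psi>_def using bij
    by (simp_all add: bij_betw_inv_into_subset[OF bij(3)] bij_betw_imp_surj_on)
  have inv: "pull (A' \<union> B') \<psi> (pull (A \<union> B) \<phi> f) = f" if "f \<in> cols k A' B'" for f
  proof (rule ext)
    fix w
    show "pull (A' \<union> B') \<psi> (pull (A \<union> B) \<phi> f) w = f w"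
    proof (cases "w \<in> A' \<union> B'")
      case True
      then have "\<psi> w \<in> A \<union> B" using \<psi> bij_betwE by blast
      moreover have "\<phi> (\<psi> w) = w"
        unfolding \<psi>_def using True bij(3) by (simp add: bij_betw_inv_into_right)
      ultimately show ?thesis using True by (simp add: pull_def)
    next
      case False
      then show ?thesis using that by (auto simp: pull_def cols_def PiE_iff extensional_def)
    qed
  qed
  obtain m where m: "m \<le> n"
    "(pull (A \<union> B) \<phi> f, pull (A \<union> B) \<phi> g) \<in> steps k A B ^^ m"
    using le pull_cols[OF bij(1,2)] fg unfolding diam_le_def reach_def by blast
  then have "(f, g) \<in> steps k A' B' ^^ m"
    using pull_relpow[OF \<psi>AB \<psi> m(2)] inv fg by simp
  then show "reach k A' B' n f g"
    unfolding reach_def using m(1) by blast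
qed

text \<open>Lets the lower bound work on the concrete parts \<open>Inl\<close> and
  \<open>Inr\<close> of \<open>nat + nat\<close>, although the given graph has an arbitrary vertex
  type.\<close>

lemma diam_le_cong:
  assumes "finite A" "finite B" "finite A'" "finite B'" "A \<inter> B = {}" "A' \<inter> B' = {}"
    and "card A = card A'" "card B = card B'"
  shows "diam_le k A B n \<longleftrightarrow> diam_le k A' B' n"
proof -
  have *: "diam_le k A' B' n"
    if fin: "finite A" "finite B" "finite A'" "finite B'" and disj: "A \<inter> B = {}" "A' \<inter> B' = {}"
      and card: "card A = card A'" "card B = card B'" and le: "diam_le k A B n"
    for A B :: "'x set" and A' B' :: "'y set"
  proof -
    obtain h1 where h1: "bij_betw h1 A A'" using fin card by (metis finite_same_card_bij)
    obtain h2 where h2: "bij_betw h2 B B'" using fin card by (metis finite_same_card_bij)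
    define \<phi> where "\<phi> = (\<lambda>v. if v \<in> A then h1 v else h2 v)"
    have 1: "bij_betw \<phi> A A'"
      using h1 by (rule bij_betw_cong[THEN iffD1, rotated]) (simp add: \<phi>_def)
    have 2: "bij_betw \<phi> B B'"
      using h2 by (rule bij_betw_cong[THEN iffD1, rotated]) (use disj in \<open>auto simp: \<phi>_def\<close>)
    show ?thesis
      using diam_le_transport[OF 1 2 bij_betw_combine[OF 1 2 disj(2)] le] .
  qed
  show ?thesis
    using *[OF assms] *[OF assms(3,4,1,2,6,5) assms(7,8)[symmetric]] by blast
qed

lemma recolouring_graph_complete_bipartite:
  assumes "complete_bipartite_digraph p q G"
  obtains A B where "finite A" "finite B" "A \<inter> B = {}" "card A = p" "card B = q"
    "recolouring_graph k G = \<lparr>pverts = cols k A B, parcs = steps k A B\<rparr>"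
proof -
  obtain A B where AB: "verts G = A \<union> B" "A \<inter> B = {}" "card A = p" "card B = q"
    "arcs_ends G = A \<times> B \<union> B \<times> A" and "graph G"
    using assms unfolding complete_bipartite_digraph_def by blast
  interpret graph G by fact
  have "finite (A \<union> B)" using finite_verts AB(1) by simp
  moreover have "colourings k G = cols k A B"
    unfolding colourings_def cols_def AB(1,5) by fastforce
  then have "recolouring_graph k G = \<lparr>pverts = cols k A B, parcs = steps k A B\<rparr>"
    unfolding recolouring_graph_def steps_def AB(1) by simp
  ultimately show ?thesis using that AB by auto
qed

section \<open>Recolouring strategies\<close>

text \<open>By \<open>cross\<close>, every mixture of \<open>f\<close> and \<open>g\<close> is
  proper, so the vertices on which they differ can be recoloured in any order, one move
  each.\<close>

lemma reach_hamming:
  assumes fin: "finite A" "finite B" and disj: "A \<inter> B = {}"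
    and "f \<in> cols k A B" "g \<in> cols k A B"
    and cross: "\<And>u v. u \<in> A \<Longrightarrow> v \<in> B \<Longrightarrow> f u \<noteq> g v \<and> g u \<noteq> f v"
  shows "reach k A B (card {v \<in> A \<union> B. f v \<noteq> g v}) f g"
  using assms(4) cross
proof (induction "card {v \<in> A \<union> B. f v \<noteq> g v}" arbitrary: f)
  case 0
  then have "f v = g v" if "v \<in> A \<union> B" for v using that fin by auto
  then have "f = g"
    using 0(2) assms(5) unfolding cols_def by (auto intro: PiE_ext)
  then show ?case using reach_refl reach_mono by auto
next
  case (Suc n)
  let ?W = "\<lambda>f. {v \<in> A \<union> B. f v \<noteq> g v}"
  obtain w where w: "w \<in> ?W f" using Suc.hyps(2) by (metis card.empty ex_in_conv nat.distinct(1))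
  define f' where "f' = f(w := g w)"
  have f'_cols: "f' \<in> cols k A B"
    using Suc.prems assms(5) w disj unfolding cols_def f'_def
    by (auto simp: PiE_iff extensional_def)
  have "?W f' = ?W f - {w}" unfolding f'_def by auto
  then have card: "n = card (?W f')" using Suc.hyps(2) w fin by auto
  have "f' u \<noteq> g v \<and> g u \<noteq> f' v" if "u \<in> A" "v \<in> B" for u v
    using Suc.prems(2)[OF that] assms(5) that unfolding f'_def cols_def by auto
  then have "reach k A B n f' g" using Suc.hyps(1)[OF card f'_cols] card by simp
  moreover have "(f, f') \<in> steps k A B"
    using Suc.prems(1) f'_cols w unfolding steps_def f'_def by auto
  then have "reach k A B 1 f f'"
    unfolding reach_def by (intro exI[of _ 1]) auto
  ultimately have "reach k A B (1 + n) f g" using reach_trans by metis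
  then show ?case using Suc.hyps(2) by simp
qed

text \<open>A stage of a strategy is described by one plain function for each part, for instance a
  constant one on \<open>A\<close>; extensionality is restored here.\<close>

definition join :: "'v set \<Rightarrow> 'v set \<Rightarrow> ('v \<Rightarrow> nat) \<Rightarrow> ('v \<Rightarrow> nat) \<Rightarrow> 'v \<Rightarrow> nat" where
  "join A B a b = (\<lambda>v. if v \<in> A then a v else if v \<in> B then b v else undefined)"

definition compat :: "nat \<Rightarrow> 'v set \<Rightarrow> 'v set \<Rightarrow> ('v \<Rightarrow> nat) \<Rightarrow> ('v \<Rightarrow> nat) \<Rightarrow> bool" where
  "compat k A B a b \<longleftrightarrow> a ` A \<subseteq> {1..k} \<and> b ` B \<subseteq> {1..k} \<and> (\<forall>u\<in>A. \<forall>v\<in>B. a u \<noteq> b v)"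

lemma join_cols: "A \<inter> B = {} \<Longrightarrow> compat k A B a b \<Longrightarrow> join A B a b \<in> cols k A B"
  unfolding join_def cols_def compat_def by (auto simp: PiE_iff extensional_def image_subset_iff)

lemma cols_compat: "f \<in> cols k A B \<Longrightarrow> compat k A B f f"
  unfolding cols_def compat_def by (auto simp: PiE_iff)

lemma cols_join: "f \<in> cols k A B \<Longrightarrow> join A B f f = f"
  unfolding join_def cols_def by (auto simp: PiE_iff extensional_def)

lemma compat_right:
  assumes "compat k A B a b" "v \<in> B"
  shows "b v \<in> {1..k}" "b v \<notin> a ` A"
  using assms unfolding compat_def by fastforce+

lemma compatI:
  assumes "a ` A \<subseteq> {1..k}" "\<And>v. v \<in> B \<Longrightarrow> b v \<in> {1..k} \<and> b v \<notin> a ` A"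
  shows "compat k A B a b"
  using assms unfolding compat_def by (metis image_eqI image_subsetI)

lemma compat_left: "compat k A B a b \<Longrightarrow> a ` A \<subseteq> {1..k}"
  unfolding compat_def by blast

lemma reach_change_right:
  assumes "finite A" "finite B" "A \<inter> B = {}" "compat k A B a b" "compat k A B a b'"
  shows "reach k A B (\<Sum>v\<in>B. of_bool (b v \<noteq> b' v)) (join A B a b) (join A B a b')"
proof -
  have "{v \<in> A \<union> B. join A B a b v \<noteq> join A B a b' v} = {v \<in> B. b v \<noteq> b' v}"
    using assms(3) unfolding join_def by auto
  moreover have "join A B a b u \<noteq> join A B a b' v \<and> join A B a b' u \<noteq> join A B a b v"
    if "u \<in> A" "v \<in> B" for u v
    using that assms(3-5) unfolding join_def compat_def by auto
  ultimately show ?thesis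
    using reach_hamming[OF assms(1-3) join_cols[OF assms(3,4)] join_cols[OF assms(3,5)]]
      card_eq_sum_of_bool[OF assms(2)] by metis
qed

lemma reach_change_left:
  assumes "finite A" "finite B" "A \<inter> B = {}" "compat k A B a b" "compat k A B a' b"
  shows "reach k A B (\<Sum>v\<in>A. of_bool (a v \<noteq> a' v)) (join A B a b) (join A B a' b)"
proof -
  have "{v \<in> A \<union> B. join A B a b v \<noteq> join A B a' b v} = {v \<in> A. a v \<noteq> a' v}"
    using assms(3) unfolding join_def by auto
  moreover have "join A B a b u \<noteq> join A B a' b v \<and> join A B a' b u \<noteq> join A B a b v"
    if "u \<in> A" "v \<in> B" for u v
    using that assms(3-5) unfolding join_def compat_def by auto
  ultimately show ?thesis
    using reach_hamming[OF assms(1-3) join_cols[OF assms(3,4)] join_cols[OF assms(3,5)]]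
      card_eq_sum_of_bool[OF assms(1)] by metis
qed

text \<open>The value 3 arises because the two parking colours of a vertex coloured \<open>e\<close> at both ends may have
  to differ: the first avoids \<open>\<alpha> ` A\<close>, the second \<open>\<beta> ` A\<close>.\<close>

definition hub_cost :: "'v set \<Rightarrow> ('v \<Rightarrow> nat) \<Rightarrow> ('v \<Rightarrow> nat) \<Rightarrow> nat \<Rightarrow> 'v \<Rightarrow> nat" where
  "hub_cost A \<alpha> \<beta> e v =
    (if \<alpha> v = e \<and> \<beta> v = e then 3
     else if \<alpha> v = e \<and> \<beta> v \<in> \<alpha> ` A \<or> \<beta> v = e \<and> \<alpha> v \<in> \<beta> ` A then 2
     else of_bool (\<alpha> v \<noteq> \<beta> v))"

text \<open>Five stages: \<open>B\<close> vacates \<open>e\<close> (colours \<open>b1\<close>),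
  \<open>A\<close> moves to \<open>e\<close>, \<open>B\<close> moves on to \<open>b2\<close>,
  \<open>A\<close> takes its final colours, \<open>B\<close> takes its final colours. A parking
  colour is required only at an end where \<open>e\<close> occurs on \<open>B\<close>.\<close>

lemma reach_hub:
  assumes fin: "finite A" "finite B" "A \<inter> B = {}"
    and \<alpha>: "\<alpha> \<in> cols k A B" and \<beta>: "\<beta> \<in> cols k A B" and e: "e \<in> {1..k}"
    and s: "e \<in> \<alpha> ` B \<Longrightarrow> \<exists>s\<in>{1..k}. s \<noteq> e \<and> s \<notin> \<alpha> ` A"
    and t: "e \<in> \<beta> ` B \<Longrightarrow> \<exists>t\<in>{1..k}. t \<noteq> e \<and> t \<notin> \<beta> ` A"
  shows "reach k A B ((\<Sum>v\<in>A. of_bool (\<alpha> v \<noteq> e)) + (\<Sum>v\<in>A. of_bool (e \<noteq> \<beta> v))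
    + (\<Sum>v\<in>B. hub_cost A \<alpha> \<beta> e v)) \<alpha> \<beta>"
proof -
  obtain s where s: "e \<in> \<alpha> ` B \<Longrightarrow> s \<in> {1..k} \<and> s \<noteq> e \<and> s \<notin> \<alpha> ` A" using s by blast
  obtain t where t: "e \<in> \<beta> ` B \<Longrightarrow> t \<in> {1..k} \<and> t \<noteq> e \<and> t \<notin> \<beta> ` A" using t by blast
  \<comment> \<open>A vertex parks on its target, or is parked at its starting colour before the
    final move to \<open>e\<close>, whenever that colour is admissible; this costs nothing extra.
    \<open>s\<close> and \<open>t\<close> are the fallbacks.\<close>
  define b1 where "b1 = (\<lambda>v. if \<alpha> v \<noteq> e then \<alpha> v
    else if \<beta> v \<noteq> e \<and> \<beta> v \<notin> \<alpha> ` A then \<beta> v else s)"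
  define b2 where "b2 = (\<lambda>v. if \<beta> v \<noteq> e then \<beta> v
    else if \<alpha> v \<noteq> e \<and> \<alpha> v \<notin> \<beta> ` A then \<alpha> v else t)"
  note compat = cols_compat[OF \<alpha>] cols_compat[OF \<beta>]
  have B: "\<alpha> v \<in> {1..k}" "\<beta> v \<in> {1..k}" "\<alpha> v \<notin> \<alpha> ` A" "\<beta> v \<notin> \<beta> ` A"
    "\<alpha> v \<in> \<alpha> ` B" "\<beta> v \<in> \<beta> ` B" if "v \<in> B" for v
    using that compat_right[OF compat(1)] compat_right[OF compat(2)] by blast+
  have b1: "b1 v \<in> {1..k} \<and> b1 v \<noteq> e \<and> b1 v \<notin> \<alpha> ` A" if "v \<in> B" for v
    using B[OF that] s unfolding b1_def by (cases "\<alpha> v = e") simp_all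
  have b2: "b2 v \<in> {1..k} \<and> b2 v \<noteq> e \<and> b2 v \<notin> \<beta> ` A" if "v \<in> B" for v
    using B[OF that] t unfolding b2_def by (cases "\<beta> v = e") simp_all
  have c1: "compat k A B \<alpha> b1"
    using compatI[OF compat_left[OF compat(1)]] b1 by simp
  have c2: "compat k A B (\<lambda>_. e) b1" and c3: "compat k A B (\<lambda>_. e) b2"
    unfolding compat_def using b1 b2 e by (simp_all add: image_subset_iff) (metis b1, metis b2)
  have c4: "compat k A B \<beta> b2"
    using compatI[OF compat_left[OF compat(2)]] b2 by simp
  have "reach k A B ((\<Sum>v\<in>B. of_bool (\<alpha> v \<noteq> b1 v)) + (\<Sum>v\<in>A. of_bool (\<alpha> v \<noteq> e))
    + (\<Sum>v\<in>B. of_bool (b1 v \<noteq> b2 v)) + (\<Sum>v\<in>A. of_bool (e \<noteq> \<beta> v))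
    + (\<Sum>v\<in>B. of_bool (b2 v \<noteq> \<beta> v))) (join A B \<alpha> \<alpha>) (join A B \<beta> \<beta>)"
    using reach_trans[OF reach_trans[OF reach_trans[OF reach_trans[OF
        reach_change_right[OF fin compat(1) c1]
        reach_change_left[OF fin c1 c2]]
        reach_change_right[OF fin c2 c3]]
        reach_change_left[OF fin c3 c4]]
        reach_change_right[OF fin c4 compat(2)]] .
  then have "reach k A B ((\<Sum>v\<in>A. of_bool (\<alpha> v \<noteq> e)) + (\<Sum>v\<in>A. of_bool (e \<noteq> \<beta> v))
    + (\<Sum>v\<in>B. of_bool (\<alpha> v \<noteq> b1 v) + of_bool (b1 v \<noteq> b2 v) + of_bool (b2 v \<noteq> \<beta> v))) \<alpha> \<beta>"
    unfolding cols_join[OF \<alpha>] cols_join[OF \<beta>] sum.distrib by (simp add: algebra_simps)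
  moreover have "(\<Sum>v\<in>B. of_bool (\<alpha> v \<noteq> b1 v) + of_bool (b1 v \<noteq> b2 v) + of_bool (b2 v \<noteq> \<beta> v))
    \<le> (\<Sum>v\<in>B. hub_cost A \<alpha> \<beta> e v)"
  proof (rule sum_mono)
    fix v assume v: "v \<in> B"
    then show "of_bool (\<alpha> v \<noteq> b1 v) + of_bool (b1 v \<noteq> b2 v) + of_bool (b2 v \<noteq> \<beta> v)
      \<le> hub_cost A \<alpha> \<beta> e v"
      using B(3,4)[OF v] unfolding hub_cost_def b1_def b2_def by simp
  qed
  ultimately show ?thesis by (meson reach_mono add_left_mono)
qed

definition relay_cost :: "('v \<Rightarrow> nat) \<Rightarrow> ('v \<Rightarrow> nat) \<Rightarrow> nat \<Rightarrow> nat \<Rightarrow> 'v \<Rightarrow> nat" where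
  "relay_cost \<alpha> \<beta> c d v =
    (if \<alpha> v = d \<and> \<beta> v = c then 2 else of_bool (\<alpha> v \<noteq> \<beta> v))"

text \<open>\<open>A\<close> can move to \<open>c\<close> at once and leave from \<open>d\<close> at
  the end, since \<open>B\<close> does not use these colours then. Only in between, when
  \<open>A\<close> changes from \<open>c\<close> to \<open>d\<close>, must \<open>B\<close> avoid
  both.\<close>

lemma reach_relay:
  assumes fin: "finite A" "finite B" "A \<inter> B = {}"
    and \<alpha>: "\<alpha> \<in> cols k A B" and \<beta>: "\<beta> \<in> cols k A B" and "3 \<le> k"
    and c: "c \<in> {1..k}" "c \<notin> \<alpha> ` B" and d: "d \<in> {1..k}" "d \<notin> \<beta> ` B"
  shows "reach k A B ((\<Sum>v\<in>A. of_bool (\<alpha> v \<noteq> c)) + card A + (\<Sum>v\<in>A. of_bool (d \<noteq> \<beta> v))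
    + (\<Sum>v\<in>B. relay_cost \<alpha> \<beta> c d v)) \<alpha> \<beta>"
proof -
  \<comment> \<open>Three colours are needed for a vertex of \<open>B\<close> that goes from
    \<open>d\<close> to \<open>c\<close>: it has to wait on a third one.\<close>
  have "\<not> {1..k} \<subseteq> {c, d}"
  proof
    assume "{1..k} \<subseteq> {c, d}"
    then have "card {1..k} \<le> card {c, d}" by (intro card_mono) auto
    then show False using \<open>3 \<le> k\<close> card_insert_le_m1[of 2 "{d}" c] by simp
  qed
  then obtain s where s: "s \<in> {1..k}" "s \<noteq> c" "s \<noteq> d" by blast
  define b where "b = (\<lambda>v. if \<alpha> v \<noteq> d then \<alpha> v else if \<beta> v \<noteq> c then \<beta> v else s)"
  note compat = cols_compat[OF \<alpha>] cols_compat[OF \<beta>]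
  have b: "b v \<in> {1..k} \<and> b v \<noteq> c \<and> b v \<noteq> d" if "v \<in> B" for v
  proof -
    have "\<alpha> v \<in> {1..k}" "\<beta> v \<in> {1..k}" "\<alpha> v \<noteq> c" "\<beta> v \<noteq> d"
      using that compat_right[OF compat(1) that] compat_right[OF compat(2) that] c d by auto
    then show ?thesis using s unfolding b_def by simp
  qed
  have c1: "compat k A B (\<lambda>_. c) \<alpha>"
    using c compat unfolding compat_def by (auto simp: image_subset_iff)
  have c2: "compat k A B (\<lambda>_. c) b" and c3: "compat k A B (\<lambda>_. d) b"
    using b c d unfolding compat_def by (force simp: image_subset_iff)+
  have c4: "compat k A B (\<lambda>_. d) \<beta>"
    using d compat unfolding compat_def by (auto simp: image_subset_iff)
  have "reach k A B ((\<Sum>v\<in>A. of_bool (\<alpha> v \<noteq> c)) + (\<Sum>v\<in>B. of_bool (\<alpha> v \<noteq> b v))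
    + (\<Sum>v\<in>A. of_bool (c \<noteq> d)) + (\<Sum>v\<in>B. of_bool (b v \<noteq> \<beta> v))
    + (\<Sum>v\<in>A. of_bool (d \<noteq> \<beta> v))) (join A B \<alpha> \<alpha>) (join A B \<beta> \<beta>)"
    using reach_trans[OF reach_trans[OF reach_trans[OF reach_trans[OF
        reach_change_left[OF fin compat(1) c1]
        reach_change_right[OF fin c1 c2]]
        reach_change_left[OF fin c2 c3]]
        reach_change_right[OF fin c3 c4]]
        reach_change_left[OF fin c4 compat(2)]] .
  then have "reach k A B ((\<Sum>v\<in>A. of_bool (\<alpha> v \<noteq> c)) + (\<Sum>v\<in>A. of_bool (c \<noteq> d))
    + (\<Sum>v\<in>A. of_bool (d \<noteq> \<beta> v))
    + (\<Sum>v\<in>B. of_bool (\<alpha> v \<noteq> b v) + of_bool (b v \<noteq> \<beta> v))) \<alpha> \<beta>"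
    unfolding cols_join[OF \<alpha>] cols_join[OF \<beta>] sum.distrib by (simp add: algebra_simps)
  moreover have "(\<Sum>v\<in>B. of_bool (\<alpha> v \<noteq> b v) + of_bool (b v \<noteq> \<beta> v))
    \<le> (\<Sum>v\<in>B. relay_cost \<alpha> \<beta> c d v)"
    by (rule sum_mono) (auto simp: relay_cost_def b_def)
  moreover have "(\<Sum>v\<in>A. of_bool (c \<noteq> d)) \<le> card A" by simp
  ultimately show ?thesis by (elim reach_mono) (intro add_mono order_refl)
qed

section \<open>Averaging over strategies\<close>

lemma sum_of_bool_neq:
  assumes "finite S"
  shows "int (\<Sum>v\<in>S. of_bool (f v \<noteq> e)) = int (card S) - int (card {v \<in> S. f v = e})"
proof -
  have "card {v \<in> S. f v \<noteq> e} = card S - card {v \<in> S. f v = e}"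
    using assms by (subst card_Diff_subset[symmetric]) (auto intro!: arg_cong[of _ _ card])
  moreover have "card {v \<in> S. f v = e} \<le> card S" using assms by (simp add: card_mono)
  ultimately show ?thesis
    using card_eq_sum_of_bool[OF assms, of "\<lambda>v. f v \<noteq> e"] by (simp add: of_nat_diff)
qed

lemma sum_const_le:
  fixes m :: int
  assumes "\<And>e. e \<in> S \<Longrightarrow> m \<le> f e"
  shows "int (card S) * m \<le> (\<Sum>e\<in>S. f e)"
  using sum_mono[of S "\<lambda>_. m" f] assms by simp

text \<open>A hypothetical counterexample to the bound 2p + q + t. Each strategy being too long
  becomes an inequality, and their sums bound \<open>card B\<close> from below.\<close>

locale far_pair =
  fixes k :: nat and A B :: "'v set" and \<alpha> \<beta> :: "'v \<Rightarrow> nat" and t :: nat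
  assumes fin: "finite A" "finite B" "A \<inter> B = {}" and A_nonempty: "A \<noteq> {}" and k: "3 \<le> k"
    and \<alpha>: "\<alpha> \<in> cols k A B" and \<beta>: "\<beta> \<in> cols k A B"
    and far: "\<not> reach k A B (2 * card A + card B + t) \<alpha> \<beta>"
begin

definition "C = {1..k} - \<alpha> ` B"
definition "D = {1..k} - \<beta> ` B"
definition "R = {1..k} - C - D"

text \<open>Moves saved because these vertices of \<open>A\<close> already have the colour of the
  hub or relay.\<close>

definition "a c = int (card {v \<in> A. \<alpha> v = c})"
definition "b d = int (card {v \<in> A. \<beta> v = d})"

text \<open>Excess over the one move per vertex of \<open>B\<close> contained in the term q; it is
  -1 for a vertex that need not move at all.\<close>

definition "hubx e v = int (hub_cost A \<alpha> \<beta> e v) - 1"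
definition "relx c d v = int (relay_cost \<alpha> \<beta> c d v) - 1"

lemma hub_excess:
  assumes "e \<in> {1..k}" "e \<in> \<alpha> ` B \<Longrightarrow> \<exists>s\<in>{1..k}. s \<noteq> e \<and> s \<notin> \<alpha> ` A"
    "e \<in> \<beta> ` B \<Longrightarrow> \<exists>t\<in>{1..k}. t \<noteq> e \<and> t \<notin> \<beta> ` A"
  shows "int t + 1 + a e + b e \<le> (\<Sum>v\<in>B. hubx e v)"
proof -
  let ?n = "(\<Sum>v\<in>A. of_bool (\<alpha> v \<noteq> e)) + (\<Sum>v\<in>A. of_bool (e \<noteq> \<beta> v))
    + (\<Sum>v\<in>B. hub_cost A \<alpha> \<beta> e v)"
  have "2 * card A + card B + t < ?n"
    using reach_hub[OF fin \<alpha> \<beta> assms] far reach_mono by (meson not_le_imp_less)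
  then have "int (2 * card A + card B + t) < int ?n" by linarith
  moreover have "int (\<Sum>v\<in>A. of_bool (e \<noteq> \<beta> v)) = int (card A) - b e"
    unfolding b_def using sum_of_bool_neq[OF fin(1), of \<beta> e] by (simp add: eq_commute)
  moreover have "int (\<Sum>v\<in>A. of_bool (\<alpha> v \<noteq> e)) = int (card A) - a e"
    unfolding a_def by (rule sum_of_bool_neq[OF fin(1)])
  moreover have "(\<Sum>v\<in>B. hubx e v) = int (\<Sum>v\<in>B. hub_cost A \<alpha> \<beta> e v) - int (card B)"
    unfolding hubx_def sum_subtractf by simp
  ultimately show ?thesis by linarith
qed

lemma relay_excess:
  assumes "c \<in> C" "d \<in> D"
  shows "int t + 1 + a c + b d - int (card A) \<le> (\<Sum>v\<in>B. relx c d v)"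
proof -
  let ?n = "(\<Sum>v\<in>A. of_bool (\<alpha> v \<noteq> c)) + card A + (\<Sum>v\<in>A. of_bool (d \<noteq> \<beta> v))
    + (\<Sum>v\<in>B. relay_cost \<alpha> \<beta> c d v)"
  have "2 * card A + card B + t < ?n"
    using reach_relay[OF fin \<alpha> \<beta> k, of c d] assms far reach_mono
    unfolding C_def D_def by (metis DiffE not_le_imp_less)
  then have "int (2 * card A + card B + t) < int ?n" by linarith
  moreover have "int (\<Sum>v\<in>A. of_bool (d \<noteq> \<beta> v)) = int (card A) - b d"
    unfolding b_def using sum_of_bool_neq[OF fin(1), of \<beta> d] by (simp add: eq_commute)
  moreover have "int (\<Sum>v\<in>A. of_bool (\<alpha> v \<noteq> c)) = int (card A) - a c"
    unfolding a_def by (rule sum_of_bool_neq[OF fin(1)])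
  moreover have "(\<Sum>v\<in>B. relx c d v) = int (\<Sum>v\<in>B. relay_cost \<alpha> \<beta> c d v) - int (card B)"
    unfolding relx_def sum_subtractf by simp
  ultimately show ?thesis by linarith
qed

lemma a_nonneg: "0 \<le> a c" and b_nonneg: "0 \<le> b d"
  unfolding a_def b_def by simp_all

lemma image_A: "\<alpha> ` A \<subseteq> C" "\<beta> ` A \<subseteq> D"
  using \<alpha> \<beta> unfolding C_def D_def cols_def by (auto simp: PiE_iff)

lemma image_B: "\<alpha> ` B \<subseteq> {1..k} - C" "\<beta> ` B \<subseteq> {1..k} - D"
  using \<alpha> \<beta> unfolding C_def D_def cols_def by (auto simp: PiE_iff)

lemma finite_CDR [simp]: "finite C" "finite D" "finite R"
  unfolding C_def D_def R_def by auto

lemma nonempty: "C \<noteq> {}" "D \<noteq> {}"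
  using image_A A_nonempty by auto

lemma disjoint: "C \<inter> D = {}"
proof (rule ccontr)
  assume "C \<inter> D \<noteq> {}"
  then obtain e where e: "e \<in> {1..k}" "e \<notin> \<alpha> ` B" "e \<notin> \<beta> ` B"
    unfolding C_def D_def by blast
  then have "(\<Sum>v\<in>B. hubx e v) \<le> 0"
    by (intro sum_nonpos) (auto simp: hubx_def hub_cost_def)
  then show False using hub_excess[OF e(1)] e(2,3) a_nonneg[of e] b_nonneg[of e] by simp
qed

lemma union: "{1..k} = C \<union> (D \<union> R)"
  unfolding R_def C_def D_def by auto

lemma disjoint_R: "C \<inter> (D \<union> R) = {}" "D \<inter> R = {}"
  using disjoint unfolding R_def by auto

lemma card_CDR: "card C + card D + card R = k"
proof -
  have "k = card (C \<union> (D \<union> R))" unfolding union[symmetric] by simp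
  also have "\<dots> = card C + (card D + card R)"
    using disjoint_R by (simp add: card_Un_disjoint)
  finally show ?thesis by simp
qed

lemma sum_a: "(\<Sum>c\<in>C. a c) = int (card A)"
proof -
  have "(\<Sum>c\<in>C. card {u \<in> A. \<alpha> u = c}) = card A"
    using sum.group[OF fin(1) finite_CDR(1) image_A(1), of "\<lambda>_. 1::nat"] by simp
  then show ?thesis unfolding a_def of_nat_sum[symmetric] by simp
qed

lemma sum_b: "(\<Sum>d\<in>D. b d) = int (card A)"
proof -
  have "(\<Sum>d\<in>D. card {u \<in> A. \<beta> u = d}) = card A"
    using sum.group[OF fin(1) finite_CDR(2) image_A(2), of "\<lambda>_. 1::nat"] by simp
  then show ?thesis unfolding b_def of_nat_sum[symmetric] by simp
qed

lemma hub_spare: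
  assumes "e \<in> D \<union> R" "e' \<in> D \<union> R" "e' \<noteq> e"
  shows "\<exists>s\<in>{1..k}. s \<noteq> e \<and> s \<notin> \<alpha> ` A"
  using assms image_A(1) disjoint_R(1) union by (intro bexI[of _ e']) auto

text \<open>A vertex with equal colours at both ends has excess 2 when its own colour is the hub and
  -1 at every other hub.\<close>

lemma sum_hubx_fixed:
  assumes "v \<in> B" "\<alpha> v = \<beta> v" "finite S" "\<alpha> v \<in> S"
  shows "(\<Sum>e\<in>S. hubx e v) = 3 - int (card S)"
proof -
  have "\<beta> v \<notin> \<alpha> ` A" "\<alpha> v \<notin> \<beta> ` A"
    using assms(1,2) image_A image_B unfolding C_def D_def by force+
  then have "(\<Sum>e\<in>S. hubx e v) = (\<Sum>e\<in>S. (if e = \<alpha> v then 3 else 0) - 1)"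
    using assms(2) by (intro sum.cong) (auto simp: hubx_def hub_cost_def)
  also have "\<dots> = 3 - int (card S)"
    unfolding sum_subtractf using assms(3,4) by simp
  finally show ?thesis .
qed

text \<open>Only the hubs \<open>\<alpha> v\<close> and \<open>\<beta> v\<close> can disturb
  \<open>v\<close>, and only if its other colour is used on \<open>A\<close> at the relevant end,
  hence lies in \<open>C\<close>, respectively \<open>D\<close>.\<close>

lemma sum_hubx_moved:
  assumes "\<alpha> v \<noteq> \<beta> v" "finite S"
  shows "(\<Sum>e\<in>S. hubx e v) \<le> of_bool (\<alpha> v \<in> S \<and> \<beta> v \<in> C) + of_bool (\<beta> v \<in> S \<and> \<alpha> v \<in> D)"
proof -
  have "(\<Sum>e\<in>S. hubx e v) \<le>
      (\<Sum>e\<in>S. (if e = \<alpha> v then of_bool (\<beta> v \<in> C) else 0) + (if e = \<beta> v then of_bool (\<alpha> v \<in> D) else 0))"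
    using assms(1) image_A by (intro sum_mono) (auto simp: hubx_def hub_cost_def)
  also have "\<dots> = of_bool (\<alpha> v \<in> S \<and> \<beta> v \<in> C) + of_bool (\<beta> v \<in> S \<and> \<alpha> v \<in> D)"
    unfolding sum.distrib using assms(2) by (simp add: sum.delta)
  finally show ?thesis .
qed

text \<open>The core of the averaging. For a moved vertex the possible extra moves belong to
  mutually exclusive cases: (\<open>\<alpha> v\<close>, \<open>\<beta> v\<close>) in
  \<open>R\<close> x \<open>C\<close>, \<open>D\<close> x \<open>R\<close> or \<open>D\<close> x
  \<open>C\<close>. For a fixed vertex the single expensive hub is offset by the savings elsewhere,
  including at least one relay.\<close>

lemma hub_relay_pointwise:
  assumes "v \<in> B"
  shows "(\<Sum>e\<in>R. hubx e v) + (\<Sum>c\<in>C. \<Sum>d\<in>D. relx c d v) \<le> 1"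
proof (cases "\<alpha> v = \<beta> v")
  case True
  then have v: "\<alpha> v \<in> R" using assms image_B unfolding R_def by auto
  have "relx c d v = -1" if "c \<in> C" "d \<in> D" for c d
    using that True disjoint by (auto simp: relx_def relay_cost_def)
  then have "(\<Sum>c\<in>C. \<Sum>d\<in>D. relx c d v) = - (int (card C) * int (card D))" by simp
  moreover have "1 \<le> card R" "1 \<le> card C" "1 \<le> card D"
    using v nonempty finite_CDR by (auto simp: Suc_le_eq card_gt_0_iff)
  then have "1 \<le> int (card C) * int (card D)"
    by (metis mult_le_mono nat_mult_1 of_nat_1 of_nat_le_iff of_nat_mult)
  ultimately show ?thesis
    using sum_hubx_fixed[OF assms True finite_CDR(3) v] \<open>1 \<le> card R\<close> by linarith
next
  case False
  have *: "\<not> (\<alpha> v \<in> R \<and> \<alpha> v \<in> D)" "\<not> (\<beta> v \<in> R \<and> \<beta> v \<in> C)"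
    using disjoint_R by auto
  have "relx c d v = (if c = \<beta> v then if d = \<alpha> v then 1 else 0 else 0)" for c d
    using False by (auto simp: relx_def relay_cost_def)
  then have "(\<Sum>d\<in>D. relx c d v) = (if c = \<beta> v then of_bool (\<alpha> v \<in> D) else 0)" for c
    by simp
  then have "(\<Sum>c\<in>C. \<Sum>d\<in>D. relx c d v) = of_bool (\<alpha> v \<in> D \<and> \<beta> v \<in> C)" by simp
  then show ?thesis
    using sum_hubx_moved[OF False finite_CDR(3)] *
    by (cases "\<alpha> v \<in> R"; cases "\<alpha> v \<in> D"; cases "\<beta> v \<in> R"; cases "\<beta> v \<in> C"; simp)
qed

text \<open>Summing the excess of all hubs in \<open>R\<close> and all relays in \<open>C \<times> D\<close>.\<close>

lemma relay_bound:
  "(int t + 1) * int (card R) + int (card C) * int (card D) * (int t + 1 - int (card A))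
    + (int (card C) + int (card D)) * int (card A) \<le> int (card B)"
proof -
  obtain c d where cd: "c \<in> C" "d \<in> D" using nonempty by blast
  \<comment> \<open>For a hub in \<open>R\<close> the parking colours come for free:
    \<open>\<alpha>\<close> avoids \<open>d\<close> on \<open>A\<close>, and \<open>\<beta>\<close>
    avoids \<open>c\<close> there.\<close>
  have hub: "int t + 1 \<le> (\<Sum>v\<in>B. hubx e v)" if e: "e \<in> R" for e
  proof -
    have "e \<in> {1..k}" "e \<noteq> c" "e \<noteq> d" "c \<in> {1..k}" "d \<in> {1..k}" "c \<notin> \<beta> ` A" "d \<notin> \<alpha> ` A"
      using e cd disjoint disjoint_R image_A union by auto
    then have "int t + 1 + a e + b e \<le> (\<Sum>v\<in>B. hubx e v)"
      by (intro hub_excess) (auto simp: Bex_def)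
    then show ?thesis using a_nonneg[of e] b_nonneg[of e] by linarith
  qed
  have "int (card R) * (int t + 1) \<le> (\<Sum>e\<in>R. \<Sum>v\<in>B. hubx e v)"
    using hub by (rule sum_const_le)
  moreover have "(\<Sum>c\<in>C. \<Sum>d\<in>D. int t + 1 + a c + b d - int (card A))
      \<le> (\<Sum>c\<in>C. \<Sum>d\<in>D. \<Sum>v\<in>B. relx c d v)"
    by (intro sum_mono relay_excess)
  moreover have "(\<Sum>c\<in>C. \<Sum>d\<in>D. int t + 1 + a c + b d - int (card A))
      = int (card C) * int (card D) * (int t + 1 - int (card A))
        + (int (card C) + int (card D)) * int (card A)"
    by (simp add: sum.distrib sum_subtractf sum_b flip: sum_distrib_left)
      (simp add: sum_a algebra_simps)
  moreover have "(\<Sum>e\<in>R. \<Sum>v\<in>B. hubx e v) + (\<Sum>c\<in>C. \<Sum>d\<in>D. \<Sum>v\<in>B. relx c d v)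
      = (\<Sum>v\<in>B. (\<Sum>e\<in>R. hubx e v) + (\<Sum>c\<in>C. \<Sum>d\<in>D. relx c d v))"
  proof -
    have "(\<Sum>c\<in>C. \<Sum>d\<in>D. \<Sum>v\<in>B. relx c d v) = (\<Sum>c\<in>C. \<Sum>v\<in>B. \<Sum>d\<in>D. relx c d v)"
      by (intro sum.cong refl sum.swap)
    also have "\<dots> = (\<Sum>v\<in>B. \<Sum>c\<in>C. \<Sum>d\<in>D. relx c d v)" by (rule sum.swap)
    finally show ?thesis using sum.swap[of hubx B R] by (simp add: sum.distrib)
  qed
  moreover have "\<dots> \<le> (\<Sum>v\<in>B. 1)" by (intro sum_mono hub_relay_pointwise)
  ultimately show ?thesis by (simp add: mult.commute)
qed

text \<open>Summing over the hubs in \<open>D \<union> R\<close>. The assumption provides two such colours, so that a vertex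
  of \<open>B\<close> can be parked while \<open>A\<close> still carries \<open>\<alpha>\<close>.\<close>

lemma hub_bound:
  assumes "card C \<le> card D"
  shows "int (card A) + (int k - int (card C)) * (int t + 1) \<le> int (card B)"
proof -
  let ?S = "D \<union> R"
  have card_S: "card ?S = k - card C"
    using card_CDR disjoint_R by (simp add: card_Un_disjoint)
  then have card_S2: "2 \<le> card ?S" using assms card_CDR k by linarith
  have hub: "int t + 1 + b e \<le> (\<Sum>v\<in>B. hubx e v)" if e: "e \<in> ?S" for e
  proof -
    have "\<not> ?S \<subseteq> {e}"
    proof
      assume "?S \<subseteq> {e}"
      then have "card ?S \<le> card {e}" by (intro card_mono) auto
      then show False using card_S2 by simp
    qed
    then obtain e' where e': "e' \<in> ?S" "e' \<noteq> e" by blast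
    obtain c where c: "c \<in> C" using nonempty by blast
    have "c \<in> {1..k}" "c \<noteq> e" "c \<notin> \<beta> ` A" using c e union disjoint disjoint_R image_A by auto
    moreover have "e \<in> {1..k}" using e union by auto
    ultimately have "int t + 1 + a e + b e \<le> (\<Sum>v\<in>B. hubx e v)"
      using hub_spare[OF e e'] by (intro hub_excess) auto
    then show ?thesis using a_nonneg[of e] by linarith
  qed
  have "b e = 0" if "e \<in> R" for e
  proof -
    have none: "{v \<in> A. \<beta> v = e} = {}" using that image_A disjoint_R by auto
    show ?thesis unfolding b_def none by simp
  qed
  then have "(\<Sum>e\<in>?S. int t + 1 + b e) = int (card ?S) * (int t + 1) + int (card A)"
    using disjoint_R sum_b by (simp add: sum.distrib sum.union_disjoint)
  then have "int (card ?S) * (int t + 1) + int (card A) \<le> (\<Sum>e\<in>?S. \<Sum>v\<in>B. hubx e v)"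
    using sum_mono[of ?S "\<lambda>e. int t + 1 + b e" "\<lambda>e. \<Sum>v\<in>B. hubx e v"] hub by simp
  also have "\<dots> = (\<Sum>v\<in>B. \<Sum>e\<in>?S. hubx e v)" by (rule sum.swap)
  \<comment> \<open>A fixed vertex contributes 3 - |D \<union> R| \<le> 1. For a moved vertex the
    two extra moves exclude each other, since one requires \<open>\<beta> v\<close> in
    \<open>C\<close> and the other \<open>\<beta> v\<close> outside it.\<close>
  also have "\<dots> \<le> (\<Sum>v\<in>B. 1)"
  proof (rule sum_mono)
    fix v assume v: "v \<in> B"
    show "(\<Sum>e\<in>?S. hubx e v) \<le> 1"
    proof (cases "\<alpha> v = \<beta> v")
      case True
      then have "\<alpha> v \<in> ?S" using v image_B unfolding R_def by auto
      then show ?thesis using sum_hubx_fixed[OF v True, of ?S] card_S2 by simp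
    next
      case False
      have "\<not> (\<beta> v \<in> ?S \<and> \<beta> v \<in> C)" using disjoint_R by auto
      then show ?thesis
        using sum_hubx_moved[OF False, of ?S] by (cases "\<beta> v \<in> C") (auto simp: of_bool_def split: if_splits)
    qed
  qed
  finally show ?thesis using card_S card_CDR by (simp add: of_nat_diff)
qed

lemma swapped: "far_pair k A B \<beta> \<alpha> t"
  using fin A_nonempty k \<alpha> \<beta> far reach_sym by unfold_locales blast+

text \<open>Reversing paths exchanges \<open>C\<close> and \<open>D\<close>, so the smaller of them
  may be taken for \<open>C\<close>; it has at most k/2 colours.\<close>

lemma hub_bound_half:
  "int (card A) + int ((k + 1) div 2) * (int t + 1) \<le> int (card B)"
proof -
  interpret swap: far_pair k A B \<beta> \<alpha> t by (rule swapped)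
  have "swap.C = D" "swap.D = C" unfolding swap.C_def swap.D_def C_def D_def by simp_all
  then have "\<exists>m. 2 * m \<le> k \<and> int (card A) + (int k - int m) * (int t + 1) \<le> int (card B)"
    using hub_bound swap.hub_bound card_CDR by (metis add_leD1 mult_2 nat_add_left_cancel_le
      add.commute le_cases)
  then obtain m where m: "2 * m \<le> k" "int (card A) + (int k - int m) * (int t + 1) \<le> int (card B)"
    by blast
  have "int ((k + 1) div 2) \<le> int k - int m" using m(1) by linarith
  then have "int ((k + 1) div 2) * (int t + 1) \<le> (int k - int m) * (int t + 1)"
    by (rule mult_right_mono) simp
  then show ?thesis using m(2) by linarith
qed

end

section \<open>Moves forced along a path\<close>

lemma relpow_path:
  assumes "(f, g) \<in> R ^^ L"
  obtains \<gamma> where "\<gamma> 0 = f" "\<gamma> L = g" "\<And>t. t < L \<Longrightarrow> (\<gamma> t, \<gamma> (Suc t)) \<in> R"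
proof -
  obtain \<gamma> where "\<gamma> 0 = f" "\<gamma> L = g" "\<forall>t<L. (\<gamma> t, \<gamma> (Suc t)) \<in> R"
    using assms unfolding relpow_fun_conv by (elim exE conjE)
  then show ?thesis using that[of \<gamma>] by simp
qed

text \<open>Vertex \<open>i\<close> of the left part changes from \<open>c i\<close> to \<open>d i\<close>, and vertex \<open>i\<close> of the right part from
  \<open>d i\<close> to \<open>c i\<close>; so the two vertices with the same index \<open>i < p\<close> block each other.\<close>

locale recolouring_path =
  fixes p q k L :: nat and C D :: "nat set" and c d :: "nat \<Rightarrow> nat"
    and \<gamma> :: "nat \<Rightarrow> nat + nat \<Rightarrow> nat"
  assumes p: "0 < p" "p \<le> q"
    and CD: "{1..k} = C \<union> D" "C \<inter> D = {}"
    and cd: "\<And>i. i < q \<Longrightarrow> c i \<in> C" "\<And>i. i < q \<Longrightarrow> d i \<in> D"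
    and start: "\<And>i. i < p \<Longrightarrow> \<gamma> 0 (Inl i) = c i" "\<And>i. i < q \<Longrightarrow> \<gamma> 0 (Inr i) = d i"
    and stop: "\<And>i. i < p \<Longrightarrow> \<gamma> L (Inl i) = d i" "\<And>i. i < q \<Longrightarrow> \<gamma> L (Inr i) = c i"
    and step: "\<And>t. t < L \<Longrightarrow> (\<gamma> t, \<gamma> (Suc t)) \<in> steps k (Inl ` {..<p}) (Inr ` {..<q})"
begin

definition "V = Inl ` {..<p} \<union> Inr ` {..<q}"
definition "moves v = {t. t < L \<and> \<gamma> t v \<noteq> \<gamma> (Suc t) v}"

lemma finite_moves [simp]: "finite (moves v)"
  unfolding moves_def by simp

lemma c_neq_d: "i < q \<Longrightarrow> j < q \<Longrightarrow> c i \<noteq> d j"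
  using cd(1)[of i] cd(2)[of j] CD(2) by auto

lemma L_pos: "0 < L"
  using start(1)[of 0] stop(1)[of 0] p c_neq_d[of 0 0] by (cases L) simp_all

lemma col: "t \<le> L \<Longrightarrow> \<gamma> t \<in> cols k (Inl ` {..<p}) (Inr ` {..<q})"
  using step[of t] step[of "t - 1"] L_pos unfolding steps_def
  by (cases "t < L") simp_all

lemma conflict: "t \<le> L \<Longrightarrow> i < p \<Longrightarrow> j < q \<Longrightarrow> \<gamma> t (Inl i) \<noteq> \<gamma> t (Inr j)"
  using col[of t] unfolding cols_def by auto

lemma colour_left: "t \<le> L \<Longrightarrow> i < p \<Longrightarrow> \<gamma> t (Inl i) \<in> C \<union> D"
  using col[of t] unfolding cols_def CD(1)[symmetric] by (auto simp: PiE_iff)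

lemma move_unique:
  assumes "t \<in> moves u" "t \<in> moves v" "u \<in> V" "v \<in> V"
  shows "u = v"
proof -
  have t: "t < L" using assms(1) unfolding moves_def by simp
  then have "\<exists>!w. w \<in> V \<and> \<gamma> t w \<noteq> \<gamma> (Suc t) w"
    using step[OF t] unfolding steps_def V_def by simp
  moreover have "\<gamma> t u \<noteq> \<gamma> (Suc t) u" "\<gamma> t v \<noteq> \<gamma> (Suc t) v"
    using assms(1,2) unfolding moves_def by simp_all
  ultimately show ?thesis using assms(3,4) by blast
qed

text \<open>Double counting: every step moves exactly one vertex, so the length may be estimated
  vertex by vertex.\<close>

lemma sum_moves: "L = (\<Sum>v\<in>V. card (moves v))"
proof -
  have finV: "finite V" unfolding V_def by simp
  have "(\<Sum>v\<in>V. of_bool (\<gamma> t v \<noteq> \<gamma> (Suc t) v)) = (1::nat)" if t: "t < L" for t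
  proof -
    obtain w where "{v \<in> V. \<gamma> t v \<noteq> \<gamma> (Suc t) v} = {w}"
      using step[OF t] unfolding steps_def V_def[symmetric] by blast
    then show ?thesis unfolding card_eq_sum_of_bool[OF finV, symmetric] by simp
  qed
  then have "L = (\<Sum>t<L. \<Sum>v\<in>V. of_bool (\<gamma> t v \<noteq> \<gamma> (Suc t) v))" by simp
  also have "\<dots> = (\<Sum>v\<in>V. \<Sum>t<L. of_bool (\<gamma> t v \<noteq> \<gamma> (Suc t) v))" by (rule sum.swap)
  also have "\<dots> = (\<Sum>v\<in>V. card (moves v))"
    unfolding card_eq_sum_of_bool[OF finite_lessThan, symmetric] moves_def by simp
  finally show ?thesis .
qed

lemma const_if_no_move:
  assumes "i \<le> j" "j \<le> L" "moves v \<inter> {i..<j} = {}"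
  shows "\<gamma> i v = \<gamma> j v"
  using assms
proof (induction j rule: dec_induct)
  case (step j)
  then have "j \<notin> moves v" by auto
  then have "\<gamma> j v = \<gamma> (Suc j) v" using step.prems unfolding moves_def by auto
  moreover have "moves v \<inter> {i..<j} = {}" using step.prems(2) by auto
  ultimately show ?case using step.IH step.prems by simp
qed simp

lemma move_between:
  assumes "i \<le> j" "j \<le> L" "\<gamma> i v \<noteq> \<gamma> j v"
  obtains t where "t \<in> moves v" "i \<le> t" "t < j"
proof -
  have "moves v \<inter> {i..<j} \<noteq> {}" using const_if_no_move[OF assms(1,2)] assms(3) by blast
  then show ?thesis using that by auto
qed

lemma single_move:
  assumes "card (moves v) \<le> 1" "\<gamma> 0 v \<noteq> \<gamma> L v"
  obtains s where "s \<in> moves v" "s < L" "\<And>t. t \<le> s \<Longrightarrow> \<gamma> t v = \<gamma> 0 v"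
    "\<And>t. s < t \<Longrightarrow> t \<le> L \<Longrightarrow> \<gamma> t v = \<gamma> L v"
proof -
  obtain s where s: "s \<in> moves v" "s < L"
    using move_between[of 0 L v] assms(2) by auto
  then have "moves v = {s}"
    using assms(1) card_le_Suc0_iff_eq[OF finite_moves, of v] by auto
  then have "\<gamma> t v = \<gamma> 0 v" if "t \<le> s" for t
    using const_if_no_move[of 0 t v] that s(2) by auto
  moreover have "\<gamma> t v = \<gamma> L v" if "s < t" "t \<le> L" for t
    using const_if_no_move[of t L v] that \<open>moves v = {s}\<close> by auto
  ultimately show ?thesis using that s by blast
qed

lemma moves_ge_1:
  assumes "\<gamma> 0 v \<noteq> \<gamma> L v" shows "1 \<le> card (moves v)"
proof -
  obtain t where "t \<in> moves v" using move_between[of 0 L v] assms by auto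
  then have "0 < card (moves v)" by (auto simp: card_gt_0_iff)
  then show ?thesis by simp
qed

lemma moves_ge_3:
  assumes "i \<le> j" "j \<le> L" "\<gamma> 0 v \<noteq> \<gamma> i v" "\<gamma> i v \<noteq> \<gamma> j v" "\<gamma> j v \<noteq> \<gamma> L v"
  shows "3 \<le> card (moves v)"
proof -
  obtain r where r: "r \<in> moves v" "r < i"
    using move_between[of 0 i v] assms by auto
  obtain s where s: "s \<in> moves v" "i \<le> s" "s < j"
    using move_between[of i j v] assms by auto
  obtain t where t: "t \<in> moves v" "j \<le> t"
    using move_between[of j L v] assms by auto
  have "{r, s, t} \<subseteq> moves v" using r s t by auto
  then have "card {r, s, t} \<le> card (moves v)" by (rule card_mono[rotated]) simp
  then show ?thesis using r s t by auto
qed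

text \<open>If both vertices moved only once, the first to move would take the colour that the other
  still has.\<close>

lemma pair_moves:
  assumes "i < p"
  shows "3 \<le> card (moves (Inl i)) + card (moves (Inr i))"
proof (rule ccontr)
  have i: "i < q" using assms p by simp
  have ne: "\<gamma> 0 (Inl i) \<noteq> \<gamma> L (Inl i)" "\<gamma> 0 (Inr i) \<noteq> \<gamma> L (Inr i)"
    using start stop assms i c_neq_d[OF i i] by auto
  assume "\<not> 3 \<le> card (moves (Inl i)) + card (moves (Inr i))"
  then have "card (moves (Inl i)) \<le> 1" "card (moves (Inr i)) \<le> 1"
    using moves_ge_1[OF ne(1)] moves_ge_1[OF ne(2)] by auto
  then have m: "card (moves (Inl i)) \<le> 1" "card (moves (Inr i)) \<le> 1" by auto
  obtain s where s: "s \<in> moves (Inl i)" "s < L" "\<And>t. t \<le> s \<Longrightarrow> \<gamma> t (Inl i) = c i"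
      "\<And>t. s < t \<Longrightarrow> t \<le> L \<Longrightarrow> \<gamma> t (Inl i) = d i"
    using single_move[OF m(1) ne(1)] unfolding start(1)[OF assms] stop(1)[OF assms] by blast
  obtain r where r: "r \<in> moves (Inr i)" "r < L" "\<And>t. t \<le> r \<Longrightarrow> \<gamma> t (Inr i) = d i"
      "\<And>t. r < t \<Longrightarrow> t \<le> L \<Longrightarrow> \<gamma> t (Inr i) = c i"
    using single_move[OF m(2) ne(2)] unfolding start(2)[OF i] stop(2)[OF i] by blast
  have "s \<noteq> r" using move_unique[of s "Inl i" "Inr i"] s(1) r(1) assms i unfolding V_def by auto
  then consider "s < r" | "r < s" by linarith
  then show False
  proof cases
    case 1
    then show ?thesis using conflict[of r i i] s(4)[of r] r(2) r(3)[of r] assms i by auto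
  next
    case 2
    then show ?thesis using conflict[of s i i] r(4)[of s] s(2) s(3)[of s] assms i by auto
  qed
qed

text \<open>\<open>Suc T\<close> is the first time at which the left part uses a colour of \<open>D\<close>, say \<open>d0\<close>, and \<open>e\<close> the last
  time at which it uses a colour of \<open>C\<close>, say \<open>c0\<close>. A right vertex going from \<open>d0\<close> to a colour
  seen on the left at some time from \<open>T\<close> on, or to \<open>c0\<close> from a colour seen on the left at some time up
  to \<open>Suc e\<close>, cannot do so in one move.\<close>

lemma path_length:
  obtains Y Z c0 d0 where "Y \<subseteq> C" "Z \<subseteq> D" "c0 \<in> Y" "d0 \<in> Z"
    "2 * p + q + card {i. i < p \<and> c i \<notin> Y \<and> d i \<notin> Z}
      + card {i. p \<le> i \<and> i < q \<and> (d i = d0 \<and> c i \<in> Y \<or> c i = c0 \<and> d i \<in> Z)} \<le> L"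
proof -
  define inD where "inD t \<longleftrightarrow> (\<exists>i<p. \<gamma> t (Inl i) \<in> D)" for t
  define inC where "inC t \<longleftrightarrow> (\<exists>i<p. \<gamma> t (Inl i) \<in> C)" for t
  have ends_i: "\<gamma> 0 (Inl i) \<in> C" "\<gamma> 0 (Inl i) \<notin> D" "\<gamma> L (Inl i) \<in> D" "\<gamma> L (Inl i) \<notin> C"
    if "i < p" for i
    using that cd[of i] CD(2) p(2) start(1)[of i] stop(1)[of i] by auto
  have ends: "inD L" "\<not> inD 0" "inC 0" "\<not> inC L"
    using ends_i p(1) unfolding inC_def inD_def by blast+
  have "inD (Suc (L - 1))" using ends L_pos by simp
  then obtain T where T1: "inD (Suc T)" and T_min: "\<And>t. t < T \<Longrightarrow> \<not> inD (Suc t)"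
    using exists_least_iff[of "\<lambda>t. inD (Suc t)"] by auto
  then have "\<not> L - 1 < T" using \<open>inD (Suc (L - 1))\<close> by blast
  then have T: "inD (Suc T)" "T < L" using T1 L_pos by simp_all
  have noD: "\<not> inD t" if "t \<le> T" for t
    using that ends(2) T_min by (cases t) simp_all
  have outD: "\<gamma> t (Inl i) \<in> C" if "t \<le> T" "i < p" for t i
    using noD[OF that(1)] colour_left[of t i] that T(2) unfolding inD_def by auto
  have "inC T" using outD[of T 0] p unfolding inC_def by auto
  define e where "e = Max {t. t \<le> L \<and> inC t}"
  have fin: "finite {t. t \<le> L \<and> inC t}" by simp
  have "e \<in> {t. t \<le> L \<and> inC t}"
    unfolding e_def using ends(3) by (intro Max_in[OF fin]) auto
  then have e_in: "e \<le> L" "inC e" by simp_all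
  have e_max: "t \<le> e" if "t \<le> L" "inC t" for t
    unfolding e_def using that by (intro Max_ge[OF fin]) simp
  have "e \<noteq> L" using e_in ends(4) by blast
  then have e: "inC e" "e < L" "T \<le> e"
    using e_in e_max[of T] T(2) \<open>inC T\<close> by simp_all
  have outC: "\<gamma> t (Inl i) \<in> D" if "e < t" "t \<le> L" "i < p" for t i
  proof -
    have "\<not> inC t" using e_max[of t] that by auto
    then show ?thesis using colour_left[of t i] that unfolding inC_def by auto
  qed
  obtain i0 where i0: "i0 < p" "\<gamma> (Suc T) (Inl i0) \<in> D" using T(1) unfolding inD_def by blast
  obtain i1 where i1: "i1 < p" "\<gamma> e (Inl i1) \<in> C" using e(1) unfolding inC_def by blast
  define d0 where "d0 = \<gamma> (Suc T) (Inl i0)"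
  define c0 where "c0 = \<gamma> e (Inl i1)"
  \<comment> \<open>The windows start at \<open>T\<close> and end at \<open>Suc e\<close>, so that
    \<open>Inl i\<close> with \<open>c i\<close> outside \<open>Y\<close> has left
    \<open>c i\<close> by time \<open>T\<close>, and with \<open>d i\<close> outside
    \<open>Z\<close> is not yet at \<open>d i\<close> at time \<open>Suc e\<close>.\<close>
  define Y where "Y = {a \<in> C. \<exists>t i. T \<le> t \<and> t \<le> L \<and> i < p \<and> \<gamma> t (Inl i) = a}"
  define Z where "Z = {b \<in> D. \<exists>t i. t \<le> Suc e \<and> i < p \<and> \<gamma> t (Inl i) = b}"
  have YZ: "Y \<subseteq> C" "Z \<subseteq> D" "c0 \<in> Y" "d0 \<in> Z"
    unfolding Y_def Z_def c0_def d0_def using i0 i1 e T(2) by auto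
  have single_right: "\<exists>s\<in>moves (Inr i). s < L \<and> (\<forall>t\<le>s. \<gamma> t (Inr i) = d i) \<and>
      (\<forall>t. s < t \<longrightarrow> t \<le> L \<longrightarrow> \<gamma> t (Inr i) = c i)"
    if i: "i < q" and m: "card (moves (Inr i)) \<le> 1" for i
  proof -
    have ne: "\<gamma> 0 (Inr i) \<noteq> \<gamma> L (Inr i)" using start(2)[OF i] stop(2)[OF i] c_neq_d[OF i i] by simp
    show ?thesis
      using single_move[OF m ne] unfolding start(2)[OF i] stop(2)[OF i] by blast
  qed
  have right_1: "1 \<le> card (moves (Inr i))" if "i < q" for i
    using moves_ge_1[of "Inr i"] start(2)[OF that] stop(2)[OF that] c_neq_d[OF that that] by auto
  have right_2: "2 \<le> card (moves (Inr i))"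
    if i: "i < q" and cross: "d i = d0 \<and> c i \<in> Y \<or> c i = c0 \<and> d i \<in> Z" for i
  proof (rule ccontr)
    assume "\<not> 2 \<le> card (moves (Inr i))"
    then obtain s where s: "s \<in> moves (Inr i)" "s < L" "\<And>t. t \<le> s \<Longrightarrow> \<gamma> t (Inr i) = d i"
      "\<And>t. s < t \<Longrightarrow> t \<le> L \<Longrightarrow> \<gamma> t (Inr i) = c i"
      using single_right[OF i] by auto
    have moved: "s \<notin> moves (Inl j)" if "j < p" for j
      using move_unique[of s "Inl j" "Inr i"] s(1) that i unfolding V_def by auto
    from cross show False
    proof (elim disjE conjE)
      assume "d i = d0" "c i \<in> Y"
      then obtain t j where tj: "T \<le> t" "t \<le> L" "j < p" "\<gamma> t (Inl j) = c i"
        unfolding Y_def by blast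
      have "t \<le> s" using s(4)[of t] conflict[of t j i] tj i by (cases "t \<le> s") simp_all
      moreover have "s \<le> T"
        using s(3)[of "Suc T"] conflict[of "Suc T" i0 i] i0(1) i T(2) \<open>d i = d0\<close>
        unfolding d0_def by (cases "s \<le> T") simp_all
      \<comment> \<open>The single move of \<open>Inr i\<close> would coincide with the step in
        which \<open>Inl i0\<close> enters \<open>D\<close>; a step moves one vertex only. This is
        why the window of \<open>Y\<close> may include \<open>T\<close> itself.\<close>
      ultimately have "s = T" using tj by simp
      moreover have "T \<in> moves (Inl i0)"
        using outD[of T i0] i0 CD(2) T(2) unfolding moves_def by auto
      ultimately show False using moved i0(1) by blast
    next
      assume "c i = c0" "d i \<in> Z"
      then obtain t j where tj: "t \<le> Suc e" "j < p" "\<gamma> t (Inl j) = d i"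
        unfolding Z_def by blast
      have "s < t" using s(3)[of t] conflict[of t j i] tj i e(2) by (cases "s < t") simp_all
      moreover have "e \<le> s"
        using s(4)[of e] conflict[of e i1 i] i1(1) i e(2) \<open>c i = c0\<close>
        unfolding c0_def by (cases "e \<le> s") simp_all
      ultimately have "s = e" using tj by simp
      moreover have "e \<in> moves (Inl i1)"
        using outC[of "Suc e" i1] i1 CD(2) e(2) unfolding moves_def by auto
      ultimately show False using moved i1(1) by blast
    qed
  qed
  \<comment> \<open>The vertex changes between two colours of \<open>C\<close> before
    \<open>T\<close>, from \<open>C\<close> to \<open>D\<close> between \<open>T\<close> and
    \<open>Suc e\<close>, and between two colours of \<open>D\<close> afterwards.\<close>
  have left_3: "3 \<le> card (moves (Inl i))" if i: "i < p" "c i \<notin> Y" "d i \<notin> Z" for i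
  proof (rule moves_ge_3[of T "Suc e"])
    have iq: "i < q" using i p by simp
    show "\<gamma> 0 (Inl i) \<noteq> \<gamma> T (Inl i)"
    proof
      assume "\<gamma> 0 (Inl i) = \<gamma> T (Inl i)"
      then have "c i \<in> Y"
        using start(1)[OF i(1)] cd(1)[OF iq] i(1) T(2) unfolding Y_def
        by (simp, intro exI[of _ T]) auto
      then show False using i by simp
    qed
    show "\<gamma> (Suc e) (Inl i) \<noteq> \<gamma> L (Inl i)"
    proof
      assume "\<gamma> (Suc e) (Inl i) = \<gamma> L (Inl i)"
      then have "d i \<in> Z"
        using stop(1)[OF i(1)] cd(2)[OF iq] i(1) unfolding Z_def
        by (simp, intro exI[of _ "Suc e"]) auto
      then show False using i by simp
    qed
    show "\<gamma> T (Inl i) \<noteq> \<gamma> (Suc e) (Inl i)"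
      using outD[of T i] outC[of "Suc e" i] i e(2) CD(2) by auto
  qed (use e in auto)
  have "L = (\<Sum>i<p. card (moves (Inl i))) + (\<Sum>i<q. card (moves (Inr i)))"
    by (subst sum_moves, unfold V_def, subst sum.union_disjoint) (auto simp: sum.reindex)
  \<comment> \<open>Pairing equal indices gives the base cost 3p + (q - p) = 2p + q.\<close>
  also have "\<dots> = (\<Sum>i<p. card (moves (Inl i)) + card (moves (Inr i)))
      + (\<Sum>i\<in>{p..<q}. card (moves (Inr i)))"
  proof -
    have split: "{..<q} = {..<p} \<union> {p..<q}" using p by auto
    have "(\<Sum>i<q. card (moves (Inr i)))
        = (\<Sum>i<p. card (moves (Inr i))) + (\<Sum>i\<in>{p..<q}. card (moves (Inr i)))"
      unfolding split by (rule sum.union_disjoint) auto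
    then show ?thesis unfolding sum.distrib by simp
  qed
  finally have L: "L = \<dots>" .
  have "(\<Sum>i<p. 3 + of_bool (c i \<notin> Y \<and> d i \<notin> Z)) \<le> (\<Sum>i<p. card (moves (Inl i)) + card (moves (Inr i)))"
  proof (rule sum_mono)
    fix i assume i: "i \<in> {..<p}"
    then show "3 + of_bool (c i \<notin> Y \<and> d i \<notin> Z) \<le> card (moves (Inl i)) + card (moves (Inr i))"
      using pair_moves[of i] left_3[of i] right_1[of i] p(2)
      by (cases "c i \<in> Y"; cases "d i \<in> Z") simp_all
  qed
  moreover have "(\<Sum>i\<in>{p..<q}. 1 + of_bool (d i = d0 \<and> c i \<in> Y \<or> c i = c0 \<and> d i \<in> Z))
      \<le> (\<Sum>i\<in>{p..<q}. card (moves (Inr i)))"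
  proof (rule sum_mono)
    fix i assume i: "i \<in> {p..<q}"
    let ?cross = "d i = d0 \<and> c i \<in> Y \<or> c i = c0 \<and> d i \<in> Z"
    show "1 + of_bool ?cross \<le> card (moves (Inr i))"
    proof (cases ?cross)
      case True
      then have eq: "of_bool ?cross = (1::nat)" by (simp only: of_bool_eq)
      show ?thesis unfolding eq using right_2[OF _ True] i by simp
    next
      case False
      then have eq: "of_bool ?cross = (0::nat)" by (simp only: of_bool_eq)
      show ?thesis unfolding eq using right_1[of i] i by simp
    qed
  qed
  moreover have "(\<Sum>i<p. 3 + of_bool (c i \<notin> Y \<and> d i \<notin> Z)) = 3 * p + card {i. i < p \<and> c i \<notin> Y \<and> d i \<notin> Z}"
  proof -
    have eq: "card {i. i < p \<and> c i \<notin> Y \<and> d i \<notin> Z} = (\<Sum>i<p. of_bool (c i \<notin> Y \<and> d i \<notin> Z))"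
      using card_eq_sum_of_bool[OF finite_lessThan, of p "\<lambda>i. c i \<notin> Y \<and> d i \<notin> Z"]
      by (simp only: lessThan_iff)
    show ?thesis unfolding eq sum.distrib by simp
  qed
  moreover have "(\<Sum>i\<in>{p..<q}. 1 + of_bool (d i = d0 \<and> c i \<in> Y \<or> c i = c0 \<and> d i \<in> Z))
      = (q - p) + card {i. p \<le> i \<and> i < q \<and> (d i = d0 \<and> c i \<in> Y \<or> c i = c0 \<and> d i \<in> Z)}"
  proof -
    have eq: "card {i. p \<le> i \<and> i < q \<and> (d i = d0 \<and> c i \<in> Y \<or> c i = c0 \<and> d i \<in> Z)}
        = (\<Sum>i\<in>{p..<q}. of_bool (d i = d0 \<and> c i \<in> Y \<or> c i = c0 \<and> d i \<in> Z))"
      using card_eq_sum_of_bool[OF finite_atLeastLessThan, of p q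
        "\<lambda>i. d i = d0 \<and> c i \<in> Y \<or> c i = c0 \<and> d i \<in> Z"]
      by (simp only: atLeastLessThan_iff conj_assoc)
    show ?thesis unfolding eq sum.distrib by simp
  qed
  ultimately have "2 * p + q + card {i. i < p \<and> c i \<notin> Y \<and> d i \<notin> Z}
      + card {i. p \<le> i \<and> i < q \<and> (d i = d0 \<and> c i \<in> Y \<or> c i = c0 \<and> d i \<in> Z)} \<le> L"
    using L p by linarith
  then show ?thesis using that YZ by blast
qed

end

section \<open>Lower bounds from matrices of colour pairs\<close>

text \<open>Realises prescribed multiplicities by an assignment of \<open>N\<close> indices: each
  index serves an entry with unmet demand, and surplus indices go anywhere.\<close>

lemma distribute:
  fixes M :: "'c \<Rightarrow> nat"
  assumes "finite I" "I \<noteq> {}" "(\<Sum>s\<in>I. M s) \<le> N"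
  obtains f :: "nat \<Rightarrow> 'c" where "\<And>i. f i \<in> I" "\<And>s. s \<in> I \<Longrightarrow> M s \<le> card {i. i < N \<and> f i = s}"
proof -
  have "\<exists>f. (\<forall>i. f i \<in> I) \<and> (\<forall>s\<in>I. M s \<le> card {i. i < N \<and> f i = s})"
    using assms(3)
  proof (induction N arbitrary: M)
    case 0
    then have "M s = 0" if "s \<in> I" for s using that assms(1) by simp
    moreover obtain s where "s \<in> I" using assms(2) by blast
    ultimately show ?case by (intro exI[of _ "\<lambda>_. s"]) simp
  next
    case (Suc N)
    obtain r where r: "r \<in> I" "(\<Sum>s\<in>I. M s) \<noteq> 0 \<Longrightarrow> M r \<noteq> 0"
      using assms(1,2) by (metis all_not_in_conv sum.neutral)
    define M' where "M' = M(r := M r - 1)"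
    have "(\<Sum>s\<in>I. M' s) = M r - 1 + (\<Sum>s\<in>I - {r}. M s)"
      using sum.remove[OF assms(1) r(1), of M'] by (simp add: M'_def)
    moreover have "(\<Sum>s\<in>I. M s) = M r + (\<Sum>s\<in>I - {r}. M s)"
      by (rule sum.remove[OF assms(1) r(1)])
    ultimately have "(\<Sum>s\<in>I. M' s) \<le> N" using Suc.prems r(2) by linarith
    then obtain f where f: "\<forall>i. f i \<in> I" "\<forall>s\<in>I. M' s \<le> card {i. i < N \<and> f i = s}"
      using Suc.IH by blast
    define f' where "f' = f(N := r)"
    have "M s \<le> card {i. i < Suc N \<and> f' i = s}" if s: "s \<in> I" for s
    proof (cases "s = r")
      case True
      have "{i. i < Suc N \<and> f' i = s} = insert N {i. i < N \<and> f i = s}"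
        unfolding f'_def using True by (auto simp: less_Suc_eq)
      then show ?thesis using f(2) s True unfolding M'_def by fastforce
    next
      case False
      have "{i. i < Suc N \<and> f' i = s} = {i. i < N \<and> f i = s}"
        unfolding f'_def using False by (auto simp: less_Suc_eq)
      then show ?thesis using f(2) s False unfolding M'_def by fastforce
    qed
    moreover have "\<forall>i. f' i \<in> I" unfolding f'_def using f(1) r(1) by simp
    ultimately show ?case by blast
  qed
  then show ?thesis using that by blast
qed

lemma sum_le_card_preimage:
  fixes M :: "'c \<Rightarrow> nat" and N :: nat
  assumes "finite S" "\<And>s. s \<in> S \<Longrightarrow> M s \<le> card {i. i < N \<and> f i = s}"
  shows "(\<Sum>s\<in>S. M s) \<le> card {i. i < N \<and> f i \<in> S}"
proof -
  have "(\<Sum>s\<in>S. M s) \<le> (\<Sum>s\<in>S. card {i. i < N \<and> f i = s})"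
    using assms(2) by (rule sum_mono)
  also have "\<dots> = card (\<Union>s\<in>S. {i. i < N \<and> f i = s})"
  proof (rule card_UN_disjoint[symmetric, OF assms(1)])
    show "\<forall>s\<in>S. finite {i. i < N \<and> f i = s}"
      by (auto intro!: finite_subset[OF _ finite_lessThan[of N]])
  qed auto
  also have "(\<Union>s\<in>S. {i. i < N \<and> f i = s}) = {i. i < N \<and> f i \<in> S}" by auto
  finally show ?thesis .
qed

text \<open>\<open>P (a, b)\<close> and \<open>Q (a, b)\<close> bound from below the number of indices below \<open>p\<close>, respectively from
  \<open>p\<close> to \<open>q - 1\<close>, whose colour pair is the \<open>a\<close>-th colour of \<open>C\<close> and the \<open>b\<close>-th colour of \<open>D\<close>.\<close>

lemma diam_lower:
  fixes P Q :: "nat \<times> nat \<Rightarrow> nat"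
  assumes p: "0 < p" "p \<le> q" and xy: "0 < x" "0 < y" "x + y = k"
    and P: "(\<Sum>s\<in>{..<x} \<times> {..<y}. P s) \<le> p"
    and Q: "(\<Sum>s\<in>{..<x} \<times> {..<y}. Q s) \<le> q - p"
    and cost: "\<And>Y Z c0 d0. Y \<subseteq> {..<x} \<Longrightarrow> Z \<subseteq> {..<y} \<Longrightarrow> c0 \<in> Y \<Longrightarrow> d0 \<in> Z \<Longrightarrow>
      \<tau> \<le> int ((\<Sum>s\<in>({..<x} - Y) \<times> ({..<y} - Z). P s) + (\<Sum>s\<in>Y \<times> {d0} \<union> {c0} \<times> Z. Q s))"
    and diam: "diam_le k (Inl ` {..<p}) (Inr ` {..<q} :: (nat + nat) set) n"
  shows "2 * int p + int q + \<tau> \<le> int n"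
proof -
  let ?I = "{..<x} \<times> {..<y}"
  have I: "finite ?I" "?I \<noteq> {}" using xy by (auto simp: lessThan_empty_iff)
  obtain f where f: "\<And>i. f i \<in> ?I" "\<And>s. s \<in> ?I \<Longrightarrow> P s \<le> card {i. i < p \<and> f i = s}"
    using distribute[OF I P] by blast
  obtain g where g: "\<And>i. g i \<in> ?I" "\<And>s. s \<in> ?I \<Longrightarrow> Q s \<le> card {i. i < q - p \<and> g i = s}"
    using distribute[OF I Q] by blast
  \<comment> \<open>\<open>P\<close> and \<open>Q\<close> are realised separately, on the first
    \<open>p\<close> and on the last \<open>q - p\<close> indices. Rows become the colours 1..x and
    columns the colours x+1..k.\<close>
  define h where "h i = (if i < p then f i else g (i - p))" for i
  define c where "c i = Suc (fst (h i))" for i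
  define d where "d i = Suc (x + snd (h i))" for i
  define C where "C = {1..x}"
  define D where "D = {Suc x..k}"
  have h: "fst (h i) < x" "snd (h i) < y" for i
    using f(1)[of i] g(1)[of "i - p"] unfolding h_def by (auto simp: mem_Times_iff)
  have CD: "{1..k} = C \<union> D" "C \<inter> D = {}" unfolding C_def D_def using xy by auto
  have cd: "c i \<in> C" "d i \<in> D" for i
    using h[of i] xy unfolding c_def d_def C_def D_def by auto
  have neq: "c i \<noteq> d j" for i j using cd(1)[of i] cd(2)[of j] CD(2) by auto
  let ?A = "Inl ` {..<p} :: (nat + nat) set" and ?B = "Inr ` {..<q} :: (nat + nat) set"
  define \<alpha> where "\<alpha> = restrict (case_sum c d) (?A \<union> ?B)"
  define \<beta> where "\<beta> = restrict (case_sum d c) (?A \<union> ?B)"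
  have cd': "c i \<in> {1..k}" "d i \<in> {1..k}" for i
    using cd[of i] unfolding CD(1) by simp_all
  have "\<alpha> \<in> ?A \<union> ?B \<rightarrow>\<^sub>E {1..k}" "\<beta> \<in> ?A \<union> ?B \<rightarrow>\<^sub>E {1..k}"
    unfolding \<alpha>_def \<beta>_def restrict_PiE_iff using cd' by (auto split: sum.split)
  then have cols: "\<alpha> \<in> cols k ?A ?B" "\<beta> \<in> cols k ?A ?B"
    unfolding cols_def using neq neq[symmetric] by (auto simp: \<alpha>_def \<beta>_def)
  obtain L where L: "L \<le> n" "(\<alpha>, \<beta>) \<in> steps k ?A ?B ^^ L"
    using diam cols unfolding diam_le_def reach_def by blast
  obtain \<gamma> where \<gamma>: "\<gamma> 0 = \<alpha>" "\<gamma> L = \<beta>"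
    "\<And>t. t < L \<Longrightarrow> (\<gamma> t, \<gamma> (Suc t)) \<in> steps k ?A ?B"
    using relpow_path[OF L(2)] by blast
  interpret recolouring_path p q k L C D c d \<gamma>
    using p CD cd \<gamma> by unfold_locales (simp_all add: \<alpha>_def \<beta>_def)
  obtain Y Z c0 d0 where YZ: "Y \<subseteq> C" "Z \<subseteq> D" "c0 \<in> Y" "d0 \<in> Z" and length:
    "2 * p + q + card {i. i < p \<and> c i \<notin> Y \<and> d i \<notin> Z}
      + card {i. p \<le> i \<and> i < q \<and> (d i = d0 \<and> c i \<in> Y \<or> c i = c0 \<and> d i \<in> Z)} \<le> L"
    by (rule path_length)
  define Y' where "Y' = {a. a < x \<and> Suc a \<in> Y}"
  define Z' where "Z' = {b. b < y \<and> Suc (x + b) \<in> Z}"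
  obtain a0 where a0: "a0 < x" "c0 = Suc a0"
    using YZ(1,3) unfolding C_def by (cases c0) auto
  have "d0 \<in> {Suc x..k}" using YZ(2,4) unfolding D_def by blast
  then have b0': "d0 - Suc x < y" "d0 = Suc (x + (d0 - Suc x))" using xy(3) by auto
  then obtain b0 where b0: "b0 < y" "d0 = Suc (x + b0)" by blast
  have YZ': "Y' \<subseteq> {..<x}" "Z' \<subseteq> {..<y}" "a0 \<in> Y'" "b0 \<in> Z'"
    using YZ(3,4) a0 b0 unfolding Y'_def Z'_def by auto
  let ?S = "({..<x} - Y') \<times> ({..<y} - Z')" and ?T = "Y' \<times> {b0} \<union> {a0} \<times> Z'"
  have fin: "finite Y'" "finite Z'"
    using YZ'(1,2) finite_subset[OF _ finite_lessThan] by blast+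
  have "(\<Sum>s\<in>?S. P s) \<le> card {i. i < p \<and> f i \<in> ?S}"
    by (rule sum_le_card_preimage) (use f(2) in auto)
  also have "{i. i < p \<and> f i \<in> ?S} = {i. i < p \<and> c i \<notin> Y \<and> d i \<notin> Z}"
  proof -
    have "fst (f i) < x" "snd (f i) < y" for i
      using f(1)[of i] by (auto simp: mem_Times_iff)
    then show ?thesis unfolding c_def d_def Y'_def Z'_def by (auto simp: h_def mem_Times_iff)
  qed
  finally have PS: "(\<Sum>s\<in>?S. P s) \<le> card \<dots>" .
  have "(\<Sum>s\<in>?T. Q s) \<le> card {i. i < q - p \<and> g i \<in> ?T}"
    by (rule sum_le_card_preimage) (use g(2) fin YZ' in auto)
  also have "\<dots> = card ((\<lambda>i. i + p) ` {i. i < q - p \<and> g i \<in> ?T})"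
    by (rule card_image[symmetric]) (simp add: inj_on_def)
  also have "\<dots> \<le> card {i. p \<le> i \<and> i < q \<and> (d i = d0 \<and> c i \<in> Y \<or> c i = c0 \<and> d i \<in> Z)}"
  proof (rule card_mono)
    show "(\<lambda>i. i + p) ` {i. i < q - p \<and> g i \<in> ?T}
        \<subseteq> {i. p \<le> i \<and> i < q \<and> (d i = d0 \<and> c i \<in> Y \<or> c i = c0 \<and> d i \<in> Z)}"
    proof (rule image_subsetI)
      fix i assume "i \<in> {i. i < q - p \<and> g i \<in> ?T}"
      then have i: "i < q - p" "g i \<in> ?T" by simp_all
      have "c (i + p) = Suc (fst (g i))" "d (i + p) = Suc (x + snd (g i))"
        unfolding c_def d_def h_def by simp_all
      moreover have "snd (g i) = b0 \<and> Suc (fst (g i)) \<in> Y \<or> fst (g i) = a0 \<and> Suc (x + snd (g i)) \<in> Z"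
        using i(2) unfolding Y'_def Z'_def by auto
      ultimately show "i + p \<in> {i. p \<le> i \<and> i < q \<and> (d i = d0 \<and> c i \<in> Y \<or> c i = c0 \<and> d i \<in> Z)}"
        using i(1) a0(2) b0(2) by auto
    qed
    show "finite {i. p \<le> i \<and> i < q \<and> (d i = d0 \<and> c i \<in> Y \<or> c i = c0 \<and> d i \<in> Z)}"
      by (rule finite_subset[OF _ finite_lessThan[of q]]) auto
  qed
  finally have QT: "(\<Sum>s\<in>?T. Q s) \<le> \<dots>" .
  have "nat \<tau> \<le> (\<Sum>s\<in>?S. P s) + (\<Sum>s\<in>?T. Q s)"
    using cost[OF YZ'] by (simp only: nat_le_iff)
  then have "2 * p + q + nat \<tau> \<le> n" using PS QT length L(1) by linarith
  then show ?thesis by linarith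
qed

lemma card_cross:
  assumes "finite Y" "finite Z" "c0 \<in> Y" "d0 \<in> Z"
  shows "card (Y \<times> {d0} \<union> {c0} \<times> Z) + 1 = card Y + card Z"
proof -
  have "(Y \<times> {d0}) \<inter> ({c0} \<times> Z) = {(c0, d0)}" using assms by auto
  then show ?thesis
    using card_Un_Int[of "Y \<times> {d0}" "{c0} \<times> Z"] assms by (simp add: card_cartesian_product)
qed

section \<open>Circulant 0/1 matrices\<close>

text \<open>Cyclic distance from \<open>b\<close> to \<open>a\<close>. The cells with
  \<open>circ n a b < m\<close> form a circulant band with \<open>m\<close> ones in every row and
  column; integers avoid truncated subtraction.\<close>

definition circ :: "nat \<Rightarrow> nat \<Rightarrow> nat \<Rightarrow> nat" where
  "circ n a b = nat ((int a - int b) mod int n)"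

lemma circ_less: "0 < n \<Longrightarrow> circ n a b < n"
  unfolding circ_def by (simp add: nat_less_iff)

lemma small_multiple_eq:
  fixes a b n :: nat
  assumes "a < n" "b < n" "int n dvd int a - int b"
  shows "a = b"
proof (rule ccontr)
  assume "a \<noteq> b"
  then have "\<bar>int n\<bar> \<le> \<bar>int a - int b\<bar>" using assms(3) by (intro dvd_imp_le_int) auto
  then show False using assms(1,2) by linarith
qed

lemma circ_inj:
  assumes "0 < n"
  shows "inj_on (\<lambda>a. circ n a b) {..<n}" "inj_on (\<lambda>b. circ n a b) {..<n}"
proof -
  have nonneg: "0 \<le> i mod int n" for i using assms by simp
  show "inj_on (\<lambda>a. circ n a b) {..<n}"
  proof (rule inj_onI)
    fix a a' assume a: "a \<in> {..<n}" "a' \<in> {..<n}" "circ n a b = circ n a' b"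
    then have "(int a - int b) mod int n = (int a' - int b) mod int n"
      unfolding circ_def using nonneg by (simp only: eq_nat_nat_iff)
    then have "int n dvd int a - int a'" by (simp add: mod_eq_dvd_iff)
    then show "a = a'" using small_multiple_eq a by simp
  qed
  show "inj_on (\<lambda>b. circ n a b) {..<n}"
  proof (rule inj_onI)
    fix b b' assume b: "b \<in> {..<n}" "b' \<in> {..<n}" "circ n a b = circ n a b'"
    then have "(int a - int b) mod int n = (int a - int b') mod int n"
      unfolding circ_def using nonneg by (simp only: eq_nat_nat_iff)
    then have "int n dvd int b' - int b" by (simp add: mod_eq_dvd_iff)
    then show "b = b'" using small_multiple_eq[of b' n b] b by simp
  qed
qed

lemma card_less_preimage:
  assumes "inj_on f {..<n}" "\<And>a. a < n \<Longrightarrow> f a < n" "m \<le> n"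
  shows "card {a \<in> {..<n}. f a < m} = m"
proof -
  have "f ` {..<n} = {..<n}"
    using assms(1,2) by (intro card_subset_eq) (auto simp: card_image)
  then have "f ` {a \<in> {..<n}. f a < m} = {..<m}"
    using assms(3) by (auto simp: set_eq_iff image_iff) (metis lessThan_iff less_le_trans imageE)
  moreover have "inj_on f {a \<in> {..<n}. f a < m}"
    using assms(1) by (rule inj_on_subset) auto
  ultimately show ?thesis by (metis card_image card_lessThan)
qed

lemma card_circ:
  assumes "0 < n" "m \<le> n"
  shows "card {a \<in> {..<n}. circ n a b < m} = m" "card {b \<in> {..<n}. circ n a b < m} = m"
  using card_less_preimage[OF circ_inj(1)[OF assms(1)] circ_less[OF assms(1)] assms(2)]
    card_less_preimage[OF circ_inj(2)[OF assms(1)] circ_less[OF assms(1)] assms(2)] .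

lemma card_filter_Diff:
  fixes F :: "'c \<Rightarrow> bool"
  assumes "finite I" "J \<subseteq> I"
  shows "int (card {s \<in> I - J. F s}) \<ge> int (card {s \<in> I. F s}) - int (card J)"
proof -
  have "finite J" using assms finite_subset by blast
  have "{s \<in> I. F s} \<subseteq> {s \<in> I - J. F s} \<union> J" by auto
  then have "card {s \<in> I. F s} \<le> card ({s \<in> I - J. F s} \<union> J)"
    using assms \<open>finite J\<close> by (intro card_mono) auto
  also have "\<dots> \<le> card {s \<in> I - J. F s} + card J" by (rule card_Un_le)
  finally show ?thesis by linarith
qed

lemma card_filter_Diff':
  fixes F :: "'c \<Rightarrow> bool"
  assumes "finite I" "J \<subseteq> I"
  shows "int (card {s \<in> J. F s}) \<ge> int (card {s \<in> I. F s}) - (int (card I) - int (card J))"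
proof -
  have "I - (I - J) = J" using assms(2) by auto
  moreover have "int (card (I - J)) = int (card I) - int (card J)"
    using assms by (simp add: card_Diff_subset finite_subset card_mono of_nat_diff)
  ultimately show ?thesis using card_filter_Diff[OF assms(1), of "I - J" F] by simp
qed

lemma sum_filter_product:
  assumes "finite U" "finite W"
  shows "(\<Sum>s\<in>U \<times> W. of_bool (E (fst s) (snd s))) = (\<Sum>c\<in>U. card {d \<in> W. E c d})"
    "(\<Sum>s\<in>U \<times> W. of_bool (E (fst s) (snd s))) = (\<Sum>d\<in>W. card {c \<in> U. E c d})"
proof -
  have *: "(\<Sum>s\<in>U \<times> W. of_bool (E (fst s) (snd s))) = (\<Sum>c\<in>U. \<Sum>d\<in>W. of_bool (E c d) :: nat)"
    by (simp add: sum.cartesian_product case_prod_unfold)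
  show "(\<Sum>s\<in>U \<times> W. of_bool (E (fst s) (snd s))) = (\<Sum>c\<in>U. card {d \<in> W. E c d})"
    unfolding * by (intro sum.cong refl card_eq_sum_of_bool[symmetric] assms)
  show "(\<Sum>s\<in>U \<times> W. of_bool (E (fst s) (snd s))) = (\<Sum>d\<in>W. card {c \<in> U. E c d})"
    unfolding * by (subst sum.swap) (intro sum.cong refl card_eq_sum_of_bool[symmetric] assms)
qed

section \<open>Lower bounds in the three regimes\<close>

text \<open>With one colour in \<open>C\<close> every admissible \<open>Y\<close> is all of it, so
  \<open>P\<close> could not contribute. Equal entries in \<open>Q\<close> suffice, as a cross has
  at least one cell.\<close>

lemma lower_many:
  assumes "0 < p" "p \<le> q" "3 \<le> k"
    and "diam_le k (Inl ` {..<p}) (Inr ` {..<q} :: (nat + nat) set) n"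
  shows "2 * int p + int q + int ((q - p) div (k - 1)) \<le> int n"
proof -
  let ?t = "(q - p) div (k - 1)"
  show ?thesis
  proof (rule diam_lower[where x = 1 and y = "k - 1" and P = "\<lambda>_. 0" and Q = "\<lambda>_. ?t"])
    fix Y Z and c0 d0 :: nat
    assume *: "Y \<subseteq> {..<1::nat}" "Z \<subseteq> {..<k - 1}" "c0 \<in> Y" "d0 \<in> Z"
    then have fin: "finite Y" "finite Z" using finite_subset by blast+
    let ?T = "Y \<times> {d0} \<union> {c0} \<times> Z"
    have "1 \<le> card ?T" using fin *(3,4) by (auto simp: Suc_le_eq card_gt_0_iff)
    then have "1 * ?t \<le> card ?T * ?t" by (rule mult_le_mono1)
    then have "int (1 * ?t) \<le> int (card ?T * ?t)" by (simp only: of_nat_le_iff)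
    then show "int ?t \<le> int ((\<Sum>s\<in>({..<1} - Y) \<times> ({..<k - 1} - Z). 0) + (\<Sum>s\<in>?T. ?t))"
      by simp
  qed (use assms in \<open>auto simp: card_cartesian_product\<close>)
qed

lemma sum_const_rest:
  assumes "Y \<subseteq> {..<x}" "Z \<subseteq> {..<y}"
  shows "int (card (({..<x} - Y) \<times> ({..<y} - Z))) = (int x - int (card Y)) * (int y - int (card Z))"
proof -
  have "int (card ({..<m} - S)) = int m - int (card S)" if "S \<subseteq> {..<m}" for S and m :: nat
    using that card_mono[OF finite_lessThan that] finite_subset[OF that finite_lessThan]
    by (simp add: card_Diff_subset of_nat_diff)
  then show ?thesis using assms by (simp add: card_cartesian_product)
qed

text \<open>Here \<open>u\<close> and \<open>v\<close> are the sizes of \<open>Y\<close> and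
  \<open>Z\<close>. The right side is smallest for \<open>u = v = 1\<close>, because
  \<open>(y - 1) * s1 \<le> s2\<close> makes a longer cross pay for the smaller remaining block. At
  \<open>u = v = 1\<close> it equals \<open>p + w\<close> up to rounding, which costs at most
  \<open>x * y\<close>.\<close>

lemma medium_arith:
  fixes x y p q u v s1 s2 w :: int
  assumes xy: "1 \<le> x" "x \<le> y"
    and s1: "x * y * s1 \<le> p" "p < x * y * (s1 + 1)"
    and s2: "q - p < x * y * (s2 + 1)"
    and w: "x * y * w \<le> q - (x + y) * p"
    and q: "y * p \<le> q" and uv: "1 \<le> u" "u \<le> x" "1 \<le> v" "v \<le> y" and "0 \<le> s1"
  shows "p + w - x * y \<le> (x - u) * (y - v) * s1 + (u + v - 1) * s2"
proof -
  have N: "0 < x * y" using xy by simp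
  have "0 \<le> (x - 1) * (y - 1)" using xy by simp
  then have "(x - 1) * (y - 1) * p \<le> (x - 1) * (y - 1) * (x * y * (s1 + 1))"
    using s1(2) by (intro mult_left_mono) auto
  \<comment> \<open>Uses xyp + q - (x + y)p = (q - p) + (x - 1)(y - 1)p.\<close>
  then have "x * y * (p + w) < x * y * (s2 + 1 + (x - 1) * (y - 1) * (s1 + 1))"
    using w s2 by (simp add: algebra_simps)
  then have 1: "p + w < s2 + 1 + (x - 1) * (y - 1) * (s1 + 1)"
    using N mult_less_cancel_left_pos by blast
  have "(y - 1) * (x * y * s1) \<le> (y - 1) * p"
    using xy s1(1) by (intro mult_left_mono) auto
  then have "x * y * ((y - 1) * s1) < x * y * (s2 + 1)"
    using q s2 by (simp add: algebra_simps)
  then have "(y - 1) * s1 < s2 + 1" using N mult_less_cancel_left_pos by blast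
  then have "(u + v - 2) * ((y - 1) * s1) \<le> (u + v - 2) * s2"
    using uv by (intro mult_left_mono) auto
  moreover have "0 \<le> s1 * ((v - 1) * (y - x) + (u - 1) * (v - 1))"
    using uv xy \<open>0 \<le> s1\<close> by simp
  moreover have "(u + v - 2) * ((y - 1) * s1) - s1 * ((x - 1) * (y - 1) - (x - u) * (y - v))
      = s1 * ((v - 1) * (y - x) + (u - 1) * (v - 1))"
    by (simp add: algebra_simps)
  ultimately have "s1 * ((x - 1) * (y - 1) - (x - u) * (y - v)) \<le> (u + v - 2) * s2" by linarith
  then show ?thesis using 1 xy by (simp add: algebra_simps)
qed

text \<open>Both matrices are constant: \<open>p\<close> and \<open>q - p\<close> are divided by the
  number of colour pairs and rounded down.\<close>

lemma lower_medium:
  assumes "0 < p" "p \<le> q" "3 \<le> k"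
    and diam: "diam_le k (Inl ` {..<p}) (Inr ` {..<q} :: (nat + nat) set) n"
  defines "x \<equiv> k div 2" and "y \<equiv> (k + 1) div 2"
  assumes q: "y * p \<le> q"
  shows "3 * int p + int q + (int q - int k * int p) div int (x * y) - int (x * y) \<le> int n"
proof -
  have xy: "1 \<le> x" "x \<le> y" "x + y = k" using assms(3) unfolding x_def y_def by auto
  define s1 where "s1 = p div (x * y)"
  define s2 where "s2 = (q - p) div (x * y)"
  define w where "w = (int q - int k * int p) div int (x * y)"
  have N: "0 < x * y" using xy by simp
  have s1: "x * y * s1 \<le> p" "p < x * y * (s1 + 1)"
    unfolding s1_def using dividend_less_times_div[OF N, of p] by simp_all
  have s2: "x * y * s2 \<le> q - p" "q - p < x * y * (s2 + 1)"
    unfolding s2_def using dividend_less_times_div[OF N, of "q - p"] by simp_all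
  have "int (x * y) * w = int q - int k * int p - (int q - int k * int p) mod int (x * y)"
    unfolding w_def by (rule minus_mod_eq_mult_div[symmetric])
  moreover have "0 \<le> (int q - int k * int p) mod int (x * y)" using N by simp
  ultimately have w: "int (x * y) * w \<le> int q - int k * int p" by linarith
  have "2 * int p + int q + (int p + w - int (x * y)) \<le> int n"
  proof (rule diam_lower[OF assms(1,2) _ _ xy(3) _ _ _ diam,
      where P = "\<lambda>_. s1" and Q = "\<lambda>_. s2"])
    show "0 < x" "0 < y" using xy by simp_all
    show "(\<Sum>s\<in>{..<x} \<times> {..<y}. s1) \<le> p" "(\<Sum>s\<in>{..<x} \<times> {..<y}. s2) \<le> q - p"
      using s1 s2 by (simp_all add: card_cartesian_product)
    fix Y Z and c0 d0 :: nat
    assume *: "Y \<subseteq> {..<x}" "Z \<subseteq> {..<y}" "c0 \<in> Y" "d0 \<in> Z"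
    have fin: "finite Y" "finite Z"
      using finite_subset[OF *(1) finite_lessThan] finite_subset[OF *(2) finite_lessThan] by auto
    have card: "1 \<le> card Y" "card Y \<le> x" "1 \<le> card Z" "card Z \<le> y"
      using card_mono[OF _ *(1)] card_mono[OF _ *(2)] fin *(3,4)
      by (auto simp: Suc_le_eq card_gt_0_iff)
    have cross: "int (card (Y \<times> {d0} \<union> {c0} \<times> Z)) = int (card Y) + int (card Z) - 1"
      using card_cross[OF fin *(3,4)] by linarith
    have "int p + w - int x * int y
        \<le> (int x - int (card Y)) * (int y - int (card Z)) * int s1
          + (int (card Y) + int (card Z) - 1) * int s2"
    proof (rule medium_arith[where q = "int q"])
      show "int x * int y * int s1 \<le> int p" "int p < int x * int y * (int s1 + 1)"
        using s1[folded of_nat_le_iff[where 'a = int] of_nat_less_iff[where 'a = int]]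
        by (simp_all add: algebra_simps)
      show "int q - int p < int x * int y * (int s2 + 1)"
        using s2(2)[folded of_nat_less_iff[where 'a = int]] assms(2)
        by (simp add: of_nat_diff algebra_simps)
      show "int x * int y * w \<le> int q - (int x + int y) * int p"
        using w unfolding xy(3)[symmetric] by simp
      show "int y * int p \<le> int q"
        using q[folded of_nat_le_iff[where 'a = int]] by simp
    qed (use xy card in auto)
    also have "\<dots> = int ((\<Sum>s\<in>({..<x} - Y) \<times> ({..<y} - Z). s1) + (\<Sum>s\<in>Y \<times> {d0} \<union> {c0} \<times> Z. s2))"
      unfolding sum_constant of_nat_add of_nat_mult sum_const_rest[OF *(1,2)] cross of_nat_id ..
    finally show "int p + w - int (x * y) \<le> \<dots>" by simp
  qed
  then show ?thesis unfolding w_def by simp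
qed

text \<open>Here \<open>E\<close> and \<open>f\<close> are the contributions of the 0/1 parts of the matrices \<open>P\<close> and \<open>Q\<close> of
  \<open>lower_few\<close>. The three bounds on \<open>E\<close> cover complementary ranges of \<open>u\<close> and \<open>v\<close>; where all of them
  are too weak, the bound on \<open>f\<close> compensates.\<close>

lemma few_arith:
  fixes x y u v s1 s2 e \<rho> m E f :: int
  assumes xy: "1 \<le> x" "x \<le> y" "y \<le> x + 1" and uv: "1 \<le> u" "u \<le> x" "1 \<le> v" "v \<le> y"
    and e: "0 \<le> e" "e \<le> y - 2" and \<rho>: "0 \<le> \<rho>" "\<rho> < x" and s1: "0 \<le> s1"
    and s2: "s2 = (y - 1) * s1 + e" and m: "m = (if x < e + \<rho> then e + 1 else e)"
    and E: "(x - u - v) * m \<le> E" "(x - u) * (m - v) \<le> E" "(y - v) * (m - (y - x) - u) \<le> E" "0 \<le> E"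
    and f: "0 \<le> f" "u + v - 1 - 2 * (x - \<rho>) - (y - x) \<le> f"
  shows "x * s2 + \<rho> - x \<le> (x - u) * (y - v) * s1 + E + ((u + v - 1) * s2 + f)"
proof (cases "x < u + v")
  case True
  \<comment> \<open>The cross alone has at least \<open>x\<close> cells.\<close>
  have "0 \<le> s2" using s1 e xy unfolding s2 by simp
  then have "x * s2 \<le> (u + v - 1) * s2" using True by (intro mult_right_mono) auto
  moreover have "0 \<le> (x - u) * (y - v) * s1" using uv s1 by simp
  ultimately show ?thesis using E(4) f(1) \<rho> by linarith
next
  case False
  \<comment> \<open>The cross falls short of \<open>x\<close> cells by \<open>h + 1\<close>; that
    many copies of \<open>s2\<close> have to come from the block of \<open>P\<close>.\<close>
  define h where "h = x - u - v"
  have h: "0 \<le> h" "u + v = x - h" using False unfolding h_def by auto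
  have "0 \<le> (v - 1) * (y - 1 - (x - u)) * s1" using uv xy s1 by simp
  moreover have "(x - u) * (y - v) * s1 - (h + 1) * ((y - 1) * s1) = (v - 1) * (y - 1 - (x - u)) * s1"
    unfolding h_def by (simp add: algebra_simps)
  ultimately have main: "(h + 1) * ((y - 1) * s1) \<le> (x - u) * (y - v) * s1" by linarith
  have E1: "h * m \<le> E" using E(1) unfolding h_def .
  have "(h + 1) * e + \<rho> - x \<le> E + f"
  proof (cases "x < e + \<rho>")
    case False
    then show ?thesis using E1 m f(1) by (simp add: algebra_simps)
  next
    case True
    then have m: "m = e + 1" using m by simp
    have Eh: "h * e + h \<le> E" using E1 unfolding m by (simp add: algebra_simps)
    \<comment> \<open>The bounds on \<open>E\<close> for rows and columns have the form
      \<open>(a + h) * (m - a)\<close>, with \<open>a = v\<close> or \<open>a = u + (y - x)\<close>.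
      This exceeds the requirement by a product that is nonnegative for \<open>a\<close> between 1
      and \<open>e - h\<close>.\<close>
    have quad: "(h + 1) * e \<le> E" if a: "1 \<le> a" "a \<le> e - h" "(a + h) * (m - a) \<le> E" for a
    proof -
      have "0 \<le> (a - 1) * (e - h - a)" using a by simp
      moreover have "(a + h) * (m - a) - (h + 1) * e = (a - 1) * (e - h - a)"
        unfolding m by (simp add: algebra_simps)
      ultimately show ?thesis using a(3) by linarith
    qed
    consider "v \<le> e - h" | "u + (y - x) \<le> e - h" | "e + \<rho> - x \<le> h"
      | "e - h < v" "e - h < u + (y - x)" "h < e + \<rho> - x" by linarith
    then show ?thesis
    proof cases
      case 1
      have "x - u = v + h" using h by simp
      then show ?thesis using quad[of v] 1 uv E(2) \<rho> f(1) by simp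
    next
      case 2
      have eq: "u + (y - x) + h = y - v" "m - (u + (y - x)) = m - (y - x) - u" using h by simp_all
      have "(u + (y - x) + h) * (m - (u + (y - x))) \<le> E" unfolding eq by (rule E(3))
      then show ?thesis using quad[of "u + (y - x)"] 2 uv xy \<rho> f(1) by simp
    next
      case 3
      then show ?thesis using Eh f(1) by (simp add: algebra_simps)
    next
      case 4
      \<comment> \<open>The first two bounds and \<open>u + v = x - h\<close> make \<open>x\<close>
        large against \<open>e\<close>; the third then forces \<open>\<rho>\<close> to be at least
        \<open>e + 1 + (y - x)\<close>, just what the bound on \<open>f\<close> requires.\<close>
      then have "\<rho> + e - x \<le> h + f" using f(2) h xy by (smt (verit))
      then show ?thesis using Eh by (simp add: algebra_simps)
    qed
  qed
  moreover have "x * s2 + \<rho> - x = ((h + 1) * ((y - 1) * s1) + ((h + 1) * e + \<rho> - x)) + (u + v - 1) * s2"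
    unfolding s2 h_def by (simp add: algebra_simps)
  ultimately show ?thesis using main by linarith
qed

lemma sum_cross:
  assumes "finite Y" "finite Z" "c0 \<in> Y" "d0 \<in> Z"
  shows "card {c \<in> Y. F c d0} + card {d \<in> Z. F c0 d}
    \<le> (\<Sum>s\<in>Y \<times> {d0} \<union> {c0} \<times> Z. of_bool (F (fst s) (snd s))) + 1"
proof -
  let ?F = "\<lambda>s. of_bool (F (fst s) (snd s)) :: nat"
  have "(Y \<times> {d0}) \<inter> ({c0} \<times> Z) = {(c0, d0)}" using assms by auto
  then have "(\<Sum>s\<in>Y \<times> {d0} \<union> {c0} \<times> Z. ?F s) + ?F (c0, d0)
      = (\<Sum>s\<in>Y \<times> {d0}. ?F s) + (\<Sum>s\<in>{c0} \<times> Z. ?F s)"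
    using sum.union_inter[of "Y \<times> {d0}" "{c0} \<times> Z" ?F] assms by simp
  moreover have "(\<Sum>s\<in>Y \<times> {d0}. ?F s) = card {c \<in> Y. F c d0}"
    using sum_filter_product(2)[of Y "{d0}" F] assms by simp
  moreover have "(\<Sum>s\<in>{c0} \<times> Z. ?F s) = card {d \<in> Z. F c0 d}"
    using sum_filter_product(1)[of "{c0}" Z F] assms by simp
  moreover have "?F (c0, d0) \<le> 1" by simp
  ultimately show ?thesis by linarith
qed

text \<open>Three ways to count the ones left after deleting the rows \<open>Y\<close> and the
  columns \<open>Z\<close>: all ones in the kept rows minus at most \<open>m\<close> per deleted
  column; row by row, losing at most \<open>card Z\<close> each; column by column, losing
  \<open>card Y\<close> and the \<open>y - x\<close> rows missing from the full circulant.\<close>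

lemma band_bounds:
  fixes x y m :: nat
  assumes "x \<le> y" "0 < y" "m \<le> y" and Y: "Y \<subseteq> {..<x}" and Z: "Z \<subseteq> {..<y}"
  defines "B \<equiv> int (\<Sum>s\<in>({..<x} - Y) \<times> ({..<y} - Z). of_bool (circ y (snd s) (fst s) < m))"
  shows "(int x - int (card Y) - int (card Z)) * int m \<le> B"
    and "(int x - int (card Y)) * (int m - int (card Z)) \<le> B"
    and "(int y - int (card Z)) * (int m - (int y - int x) - int (card Y)) \<le> B"
proof -
  let ?U = "{..<x} - Y" and ?W = "{..<y} - Z" and ?E = "\<lambda>c d. circ y d c < m"
  have fin: "finite Y" "finite Z" "finite ?U" "finite ?W"
    using finite_subset[OF Y] finite_subset[OF Z] by auto
  have col: "card {d \<in> {..<y}. ?E c d} = m" and row: "card {c \<in> {..<y}. ?E c d} = m" for c d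
    using card_circ[OF assms(2,3)] by auto
  have card_U: "int (card ?U) = int x - int (card Y)"
    using card_mono[OF finite_lessThan Y] fin Y by (simp add: card_Diff_subset of_nat_diff)
  have card_W: "int (card ?W) = int y - int (card Z)"
    using card_mono[OF finite_lessThan Z] fin Z by (simp add: card_Diff_subset of_nat_diff)
  have B1: "B = (\<Sum>c\<in>?U. int (card {d \<in> ?W. ?E c d}))"
    unfolding B_def using sum_filter_product(1)[OF fin(3,4), of ?E] by simp
  have B2: "B = (\<Sum>d\<in>?W. int (card {c \<in> ?U. ?E c d}))"
    unfolding B_def using sum_filter_product(2)[OF fin(3,4), of ?E] by simp
  have "int m - int (card Z) \<le> int (card {d \<in> ?W. ?E c d})" for c
    using card_filter_Diff[OF finite_lessThan Z, of "?E c"] col by simp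
  then have "(\<Sum>c\<in>?U. int m - int (card Z)) \<le> B" unfolding B1 by (intro sum_mono)
  then show "(int x - int (card Y)) * (int m - int (card Z)) \<le> B"
    unfolding sum_constant card_U by simp
  have "?U \<subseteq> {..<y}" using assms(1) by auto
  then have "int m - (int y - int (card ?U)) \<le> int (card {c \<in> ?U. ?E c d})" for d
    using card_filter_Diff'[OF finite_lessThan, of ?U y "\<lambda>c. ?E c d"] row by simp
  then have "(\<Sum>d\<in>?W. int m - (int y - int (card ?U))) \<le> B" unfolding B2 by (intro sum_mono)
  then show "(int y - int (card Z)) * (int m - (int y - int x) - int (card Y)) \<le> B"
    unfolding sum_constant card_W card_U by (simp add: algebra_simps)
  have "(\<Sum>c\<in>?U. card {d \<in> {..<y}. ?E c d}) = (\<Sum>d\<in>{..<y}. card {c \<in> ?U. ?E c d})"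
    using sum_filter_product[OF fin(3) finite_lessThan, of ?E y] by simp
  also have "\<dots> = (\<Sum>d\<in>?W. card {c \<in> ?U. ?E c d}) + (\<Sum>d\<in>Z. card {c \<in> ?U. ?E c d})"
    by (rule sum.subset_diff[OF Z finite_lessThan])
  also have "(\<Sum>d\<in>Z. card {c \<in> ?U. ?E c d}) \<le> (\<Sum>d\<in>Z. m)"
  proof (rule sum_mono)
    fix d
    have "card {c \<in> ?U. ?E c d} \<le> card {c \<in> {..<y}. ?E c d}"
      using assms(1) by (intro card_mono) auto
    then show "card {c \<in> ?U. ?E c d} \<le> m" using row by simp
  qed
  finally have "card ?U * m \<le> (\<Sum>d\<in>?W. card {c \<in> ?U. ?E c d}) + card Z * m"
    using col by simp
  then have "int (card ?U * m) \<le> int ((\<Sum>d\<in>?W. card {c \<in> ?U. ?E c d}) + card Z * m)"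
    by (simp only: of_nat_le_iff)
  then have "int (card ?U) * int m \<le> B + int (card Z) * int m"
    unfolding B2 by simp
  then show "(int x - int (card Y) - int (card Z)) * int m \<le> B"
    unfolding card_U by (simp add: algebra_simps)
qed

lemma few_capacity:
  fixes x y p w s1 e \<rho> m :: int
  assumes xy: "1 \<le> x" "x \<le> y" "y \<le> x + 1" "2 \<le> y" and nonneg: "0 \<le> e" "0 \<le> \<rho>"
    and w: "w = x * ((y - 1) * s1 + e) + \<rho>" "y * w \<le> (y - 1) * p"
    and m: "m = (if x < e + \<rho> then e + 1 else e)"
  shows "x * y * s1 + x * m \<le> p"
proof -
  have "(y - 1) * (x * m) \<le> x * y * e + y * \<rho>"
  proof (cases "x < e + \<rho>")
    case True
    \<comment> \<open>Since \<open>y - 1 \<le> x < e + \<rho>\<close>, the remainder pays for the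
      additional diagonal of the band.\<close>
    have "x * (y - 1) \<le> x * (e + \<rho>)" using True xy by (intro mult_left_mono) auto
    moreover have "x * \<rho> \<le> y * \<rho>" using xy nonneg by (intro mult_right_mono) auto
    ultimately show ?thesis using True m by (simp add: algebra_simps)
  next
    case False
    then show ?thesis using m xy nonneg by (simp add: algebra_simps)
  qed
  then have "(y - 1) * (x * y * s1 + x * m) \<le> y * w" unfolding w(1) by (simp add: algebra_simps)
  then have "(y - 1) * (x * y * s1 + x * m) \<le> (y - 1) * p" using w(2) by linarith
  then show ?thesis using xy(4) by (simp add: mult_le_cancel_left)
qed

text \<open>The total of \<open>Q\<close> is \<open>y * w\<close>, spread so that a cross of
  \<open>x\<close> cells is worth about the target \<open>w\<close>. Shorter crosses leave a larger
  block of \<open>P\<close>, which makes up the difference.\<close>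

lemma lower_few:
  assumes "0 < p" "p \<le> q" "3 \<le> k"
    and diam: "diam_le k (Inl ` {..<p}) (Inr ` {..<q} :: (nat + nat) set) n"
  defines "x \<equiv> k div 2" and "y \<equiv> (k + 1) div 2"
  assumes q: "q \<le> y * p"
  shows "2 * int p + int q + int ((q - p) div y) - int x \<le> int n"
proof -
  have xy: "1 \<le> x" "x \<le> y" "x + y = k" "y \<le> x + 1" "2 \<le> y"
    using assms(3) unfolding x_def y_def by auto
  \<comment> \<open>\<open>P\<close> and \<open>Q\<close> are constant matrices plus circulant bands of widths \<open>m\<close> and \<open>\<rho>\<close>. The value of \<open>s1\<close>
    balances \<open>(y - 1) * s1\<close> against \<open>s2\<close>, and the band of \<open>P\<close> is widened only if \<open>e + \<rho>\<close> exceeds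
    the slack \<open>x\<close>; this keeps the total of \<open>P\<close> below \<open>p\<close>.\<close>
  define w where "w = (q - p) div y"
  define s2 where "s2 = w div x"
  define \<rho> where "\<rho> = w mod x"
  define s1 where "s1 = s2 div (y - 1)"
  define e where "e = s2 mod (y - 1)"
  define m where "m = (if x < e + \<rho> then e + 1 else e)"
  have \<rho>: "\<rho> < x" unfolding \<rho>_def using xy by simp
  have e: "e < y - 1" unfolding e_def using xy by simp
  have w_eq: "w = x * s2 + \<rho>" unfolding s2_def \<rho>_def by simp
  have s2_eq: "s2 = (y - 1) * s1 + e" unfolding s1_def e_def by simp
  have s2_int: "int s2 = (int y - 1) * int s1 + int e"
    unfolding s2_eq using xy(5) by (simp add: of_nat_diff)
  have w_int: "int w = int x * int s2 + int \<rho>" unfolding w_eq by simp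
  have yw: "y * w \<le> q - p" unfolding w_def by simp
  have m_int: "int m = (if int x < int e + int \<rho> then int e + 1 else int e)"
    unfolding m_def by simp
  have m_le: "m \<le> y" unfolding m_def using e by auto
  have "int (x * y * s1 + x * m) \<le> int p"
    unfolding of_nat_add of_nat_mult
  proof (rule few_capacity[where \<rho> = "int \<rho>" and w = "int w"])
    show "int w = int x * ((int y - 1) * int s1 + int e) + int \<rho>"
      using w_int s2_int by simp
    have "int (y * w) \<le> int (q - p)" using yw by (simp only: of_nat_le_iff)
    moreover have "int q \<le> int (y * p)" using q by (simp only: of_nat_le_iff)
    ultimately show "int y * int w \<le> (int y - 1) * int p"
      using assms(2) by (simp add: of_nat_diff algebra_simps)
  qed (use xy m_int in auto)
  then have cap_P: "x * y * s1 + x * m \<le> p" by (simp only: of_nat_le_iff)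
  have cap_Q: "x * y * s2 + y * \<rho> \<le> q - p" using yw unfolding w_eq by (simp add: algebra_simps)
  define E where "E c d \<longleftrightarrow> circ y d c < m" for c d
  define F where "F c d \<longleftrightarrow> circ x d c < \<rho>" for c d
  define P where "P s = s1 + of_bool (E (fst s) (snd s))" for s
  define Q where "Q s = s2 + of_bool (F (fst s) (snd s))" for s
  have colE: "card {d \<in> {..<y}. E c d} = m" for c
    unfolding E_def using card_circ(1)[of y m c] xy m_le by simp
  have rowF: "card {c \<in> {..<x}. F c d} = \<rho>" for d
    unfolding F_def using card_circ(2)[of x \<rho> d] xy \<rho> by simp
  \<comment> \<open>If \<open>y = x + 1\<close>, the band of period \<open>x\<close> wraps around
    once more, so only an inequality holds in this direction.\<close>
  have colF: "\<rho> \<le> card {d \<in> {..<y}. F c d}" for c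
  proof -
    have "\<rho> = card {d \<in> {..<x}. F c d}"
      unfolding F_def using card_circ(1)[of x \<rho> c] xy \<rho> by simp
    also have "\<dots> \<le> card {d \<in> {..<y}. F c d}" using xy(2) by (intro card_mono) auto
    finally show ?thesis .
  qed
  have "2 * int p + int q + (int w - int x) \<le> int n"
  proof (rule diam_lower[OF assms(1,2) _ _ xy(3) _ _ _ diam, where P = P and Q = Q])
    show "0 < x" "0 < y" using xy by simp_all
    show "(\<Sum>s\<in>{..<x} \<times> {..<y}. P s) \<le> p"
      unfolding P_def sum.distrib sum_filter_product(1)[OF finite_lessThan finite_lessThan] colE
      using cap_P by (simp add: card_cartesian_product)
    show "(\<Sum>s\<in>{..<x} \<times> {..<y}. Q s) \<le> q - p"
      unfolding Q_def sum.distrib sum_filter_product(2)[OF finite_lessThan finite_lessThan] rowF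
      using cap_Q by (simp add: card_cartesian_product)
    fix Y Z and c0 d0 :: nat
    assume *: "Y \<subseteq> {..<x}" "Z \<subseteq> {..<y}" "c0 \<in> Y" "d0 \<in> Z"
    let ?S = "({..<x} - Y) \<times> ({..<y} - Z)" and ?T = "Y \<times> {d0} \<union> {c0} \<times> Z"
    have fin: "finite Y" "finite Z"
      using finite_subset[OF *(1) finite_lessThan] finite_subset[OF *(2) finite_lessThan] by auto
    have card: "1 \<le> card Y" "card Y \<le> x" "1 \<le> card Z" "card Z \<le> y"
      using card_mono[OF _ *(1)] card_mono[OF _ *(2)] fin *(3,4)
      by (auto simp: Suc_le_eq card_gt_0_iff)
    have cross: "int (card ?T) = int (card Y) + int (card Z) - 1"
      using card_cross[OF fin *(3,4)] by linarith
    define B where "B = int (\<Sum>s\<in>?S. of_bool (E (fst s) (snd s)))"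
    define f where "f = int (\<Sum>s\<in>?T. of_bool (F (fst s) (snd s)))"
    \<comment> \<open>Each arm of the cross keeps the band cells of a full line except those outside
      \<open>Y\<close> or \<open>Z\<close>; the common cell is counted twice.\<close>
    have "int \<rho> - (int x - int (card Y)) \<le> int (card {c \<in> Y. F c d0})"
      using card_filter_Diff'[OF finite_lessThan *(1), of "\<lambda>c. F c d0"] rowF[of d0] by simp
    moreover have "int \<rho> - (int y - int (card Z)) \<le> int (card {d \<in> Z. F c0 d})"
      using card_filter_Diff'[OF finite_lessThan *(2), of "F c0"] colF[of c0] by simp
    moreover have "int (card {c \<in> Y. F c d0}) + int (card {d \<in> Z. F c0 d}) \<le> f + 1"
      using sum_cross[OF fin *(3,4), of F, folded of_nat_le_iff[where 'a = int]]
      unfolding f_def by simp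
    ultimately have f: "int (card Y) + int (card Z) - 1 - 2 * (int x - int \<rho>) - (int y - int x) \<le> f"
      by (smt (verit))
    have "int x * int s2 + int \<rho> - int x
        \<le> (int x - int (card Y)) * (int y - int (card Z)) * int s1 + B
          + ((int (card Y) + int (card Z) - 1) * int s2 + f)"
    proof (rule few_arith[OF _ _ _ _ _ _ _ _ _ _ _ _ s2_int m_int])
      show "(int x - int (card Y) - int (card Z)) * int m \<le> B"
        "(int x - int (card Y)) * (int m - int (card Z)) \<le> B"
        "(int y - int (card Z)) * (int m - (int y - int x) - int (card Y)) \<le> B"
        using band_bounds[OF xy(2) _ m_le *(1,2)] xy unfolding B_def E_def by auto
      show "0 \<le> B" "0 \<le> f" unfolding B_def f_def by (simp_all only: of_nat_0_le_iff)
    qed (use xy card e \<rho> f in auto)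
    also have "\<dots> = int ((\<Sum>s\<in>?S. P s) + (\<Sum>s\<in>?T. Q s))"
      unfolding P_def Q_def B_def f_def sum.distrib sum_constant of_nat_add of_nat_mult
        sum_const_rest[OF *(1,2)] cross of_nat_id ..
    finally show "int w - int x \<le> int ((\<Sum>s\<in>?S. P s) + (\<Sum>s\<in>?T. Q s))"
      using w_int by simp
  qed
  then show ?thesis unfolding w_def by simp
qed

section \<open>The diameter\<close>

context far_pair
begin

lemma hub_relay_count:
  "int k * int (card A) + (int (card R) + int (card C) * int (card D)) * (int t + 1 - int (card A))
    \<le> int (card B)"
proof -
  have "int k = int (card C) + int (card D) + int (card R)" using card_CDR by linarith
  then show ?thesis using relay_bound by (simp add: algebra_simps)
qed

lemma card_pos: "1 \<le> card C" "1 \<le> card D"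
  using nonempty by (auto simp: Suc_le_eq card_gt_0_iff)

lemma hub_relay_count_lower: "int k - 1 \<le> int (card R) + int (card C) * int (card D)"
proof -
  have "0 \<le> (int (card C) - 1) * (int (card D) - 1)" using card_pos by simp
  moreover have "int k = int (card C) + int (card D) + int (card R)" using card_CDR by linarith
  ultimately show ?thesis by (simp add: algebra_simps)
qed

text \<open>Moving the colours of \<open>R\<close> into \<open>D\<close> does not decrease the
  count, and a product with fixed sum is largest when balanced: no integer lies strictly between
  \<open>x\<close> and \<open>y\<close>.\<close>

lemma hub_relay_count_upper:
  "int (card R) + int (card C) * int (card D) \<le> int (k div 2) * int ((k + 1) div 2)"
proof -
  define x y X where "x = int (k div 2)" and "y = int ((k + 1) div 2)" and "X = int (card C)"
  have k: "int k = x + y" "x \<le> y" "y \<le> x + 1" unfolding x_def y_def by linarith+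
  have "int (card C) + int (card D) + int (card R) = int k" using card_CDR by linarith
  then have D: "int (card D) = x + y - X - int (card R)" using k unfolding X_def by linarith
  have "0 \<le> (X - 1) * int (card R)" using card_pos unfolding X_def by simp
  moreover have "0 \<le> (X - x) * (X - y)"
  proof (cases "X \<le> x")
    case True
    then show ?thesis using k by (intro mult_nonpos_nonpos) auto
  next
    case False
    then show ?thesis using k by (intro mult_nonneg_nonneg) auto
  qed
  ultimately have "int (card R) + X * (x + y - X - int (card R)) \<le> x * y"
    by (simp add: algebra_simps)
  then show ?thesis using D unfolding x_def y_def X_def by simp
qed

end

lemma diam_le_if_no_far_pair:
  assumes "finite A" "finite B" "A \<inter> B = {}" "A \<noteq> {}" "3 \<le> k"
    and "\<And>\<alpha> \<beta>. far_pair k A B \<alpha> \<beta> t \<Longrightarrow> False"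
  shows "diam_le k A B (2 * card A + card B + t)"
  unfolding diam_le_def
proof (intro ballI, rule ccontr)
  fix \<alpha> \<beta> assume "\<alpha> \<in> cols k A B" "\<beta> \<in> cols k A B"
    "\<not> reach k A B (2 * card A + card B + t) \<alpha> \<beta>"
  then have "far_pair k A B \<alpha> \<beta> t" using assms(1-5) by unfold_locales
  then show False by (rule assms(6))
qed

lemma less_mult_div_Suc:
  fixes a b :: int
  assumes "0 < b"
  shows "a < b * (a div b + 1)"
proof -
  have "b * (a div b) = a - a mod b" by (rule minus_mod_eq_mult_div[symmetric])
  then show ?thesis
    unfolding distrib_left using pos_mod_bound[OF assms, of a] by linarith
qed

text \<open>Here t + 1 > p, so the smallest possible number of strategies, k - 1, gives the weakest
  constraint, and even that contradicts the choice of t.\<close>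

lemma upper_many:
  assumes "finite A" "finite B" "A \<inter> B = {}" "A \<noteq> {}" "3 \<le> k" "k * card A \<le> card B"
  shows "diam_le k A B (2 * card A + card B + (card B - card A) div (k - 1))"
proof (rule diam_le_if_no_far_pair[OF assms(1-5)])
  fix \<alpha> \<beta> assume "far_pair k A B \<alpha> \<beta> ((card B - card A) div (k - 1))"
  then interpret far_pair k A B \<alpha> \<beta> "(card B - card A) div (k - 1)" .
  define p q t where "p = int (card A)" and "q = int (card B)"
    and "t = int ((card B - card A) div (k - 1))"
  have "card A \<le> k * card A" using assms(5) by simp
  then have le: "card A \<le> card B" using assms(6) by linarith
  have t_eq: "t = (q - p) div (int k - 1)"
    unfolding t_def p_def q_def using le assms(5) by (simp add: of_nat_diff zdiv_int)
  have t: "q - p < (int k - 1) * (t + 1)"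
    unfolding t_eq using assms(5) by (intro less_mult_div_Suc) auto
  have "int (k * card A) \<le> int (card B)" using assms(6) by (simp only: of_nat_le_iff)
  then have q: "int k * p \<le> q" unfolding p_def q_def by simp
  have "(int k - 1) * p < (int k - 1) * (t + 1)" using q t by (simp add: algebra_simps)
  then have "p < t + 1" using assms(5) by (simp add: mult_less_cancel_left)
  then have "(int k - 1) * (t + 1 - p) \<le> (int (card R) + int (card C) * int (card D)) * (t + 1 - p)"
    using hub_relay_count_lower by (intro mult_right_mono) auto
  then have "int k * p + (int k - 1) * (t + 1 - p) \<le> q"
    using hub_relay_count unfolding p_def q_def t_def by linarith
  then show False using t by (simp add: algebra_simps)
qed

lemma upper_medium:
  assumes "finite A" "finite B" "A \<inter> B = {}" "A \<noteq> {}" "3 \<le> k"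
    and "(k + 1) div 2 * card A \<le> card B" "card B \<le> k * card A"
  shows "\<exists>n. diam_le k A B n \<and> int n = 3 * int (card A) + int (card B)
    + (int (card B) - int k * int (card A)) div int (k div 2 * ((k + 1) div 2))"
proof -
  define p q m where "p = int (card A)" and "q = int (card B)" and "m = int (k div 2 * ((k + 1) div 2))"
  define w where "w = (q - int k * p) div m"
  define x y where "x = int (k div 2)" and "y = int ((k + 1) div 2)"
  have "1 \<le> k div 2" "1 \<le> (k + 1) div 2" "k = k div 2 + (k + 1) div 2"
    using assms(5) by linarith+
  then have xy: "1 \<le> x" "1 \<le> y" "int k = x + y"
    unfolding x_def y_def by linarith+
  have "m = x * y" unfolding m_def x_def y_def by simp
  note xy = xy this
  have m: "0 < m" using xy by simp
  have "int ((k + 1) div 2 * card A) \<le> int (card B)" "int (card B) \<le> int (k * card A)"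
    using assms(6,7) by (simp_all only: of_nat_le_iff)
  then have q: "y * p \<le> q" "q \<le> int k * p" unfolding p_def q_def y_def by simp_all
  have w: "q - int k * p < m * (w + 1)" unfolding w_def by (rule less_mult_div_Suc[OF m])
  \<comment> \<open>The quotient \<open>w\<close> may be negative; \<open>y * p \<le> q\<close>
    keeps the excess \<open>p + w\<close> a natural number.\<close>
  have "0 \<le> p + w"
  proof -
    have "0 \<le> p" unfolding p_def by simp
    then have "x * p \<le> x * p * y" using xy mult_left_mono[of 1 y "x * p"] by simp
    then have "m * (- p) \<le> q - int k * p" using q xy by (simp add: algebra_simps)
    then have "m * (- p) < m * (w + 1)" using w by linarith
    then have "- p < w + 1" using mult_less_cancel_left_pos[OF m] by blast
    then show ?thesis by linarith
  qed
  then obtain t where t: "int t = p + w" by (metis nonneg_int_cases)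
  have "diam_le k A B (2 * card A + card B + t)"
  proof (rule diam_le_if_no_far_pair[OF assms(1-5)])
    fix \<alpha> \<beta> assume "far_pair k A B \<alpha> \<beta> t"
    then interpret far_pair k A B \<alpha> \<beta> t .
    let ?s = "int (card R) + int (card C) * int (card D)"
    have count: "int k * p + ?s * (w + 1) \<le> q"
      using hub_relay_count t unfolding p_def q_def by simp
    show False
    proof (cases "0 \<le> w")
      case True
      have "1 \<le> ?s" using hub_relay_count_lower assms(5) by linarith
      then have "0 < ?s * (w + 1)" using True by (intro mult_pos_pos) auto
      then show ?thesis using count q(2) by linarith
    next
      case False
      \<comment> \<open>As \<open>w + 1 \<le> 0\<close>, the largest number of strategies is now the
        worst case.\<close>
      then have "m * (w + 1) \<le> ?s * (w + 1)"
        using hub_relay_count_upper unfolding m_def by (intro mult_right_mono_neg) auto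
      then show ?thesis using count w by linarith
    qed
  qed
  then show ?thesis
    using t unfolding w_def p_def q_def m_def by (intro exI[of _ "2 * card A + card B + t"]) simp
qed

lemma upper_few:
  assumes "finite A" "finite B" "A \<inter> B = {}" "A \<noteq> {}" "3 \<le> k" "card A \<le> card B"
  shows "diam_le k A B (2 * card A + card B + (card B - card A) div ((k + 1) div 2))"
proof (rule diam_le_if_no_far_pair[OF assms(1-5)])
  let ?y = "(k + 1) div 2"
  let ?t = "(card B - card A) div ?y"
  fix \<alpha> \<beta> assume "far_pair k A B \<alpha> \<beta> ?t"
  then interpret far_pair k A B \<alpha> \<beta> ?t .
  have "int (card A + ?y * (?t + 1)) \<le> int (card B)" using hub_bound_half by (simp add: algebra_simps)
  then have "card A + ?y * (?t + 1) \<le> card B" by (simp only: of_nat_le_iff)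
  moreover have "0 < ?y" using assms(5) by simp
  then have "card B - card A < ?y * (?t + 1)"
    using dividend_less_times_div[of ?y "card B - card A"] by simp
  ultimately show False by linarith
qed

text \<open>Defined on a fixed model, so that it depends on \<open>k\<close>, \<open>p\<close>,
  \<open>q\<close> only and the corrections can be chosen before the graph. The \<open>LEAST\<close>
  is meaningful once some bound is available.\<close>

definition diam :: "nat \<Rightarrow> nat \<Rightarrow> nat \<Rightarrow> nat" where
  "diam k p q = (LEAST n. diam_le k (Inl ` {..<p}) (Inr ` {..<q} :: (nat + nat) set) n)"

lemma card_model: "finite (Inl ` {..<p} :: (nat + nat) set)" "finite (Inr ` {..<q} :: (nat + nat) set)"
  "(Inl ` {..<p} :: (nat + nat) set) \<inter> Inr ` {..<q} = {}"
  "card (Inl ` {..<p} :: (nat + nat) set) = p" "card (Inr ` {..<q} :: (nat + nat) set) = q"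
  by (auto simp: card_image inj_on_def)

lemma cols_nonempty:
  assumes "2 \<le> k" "A \<inter> B = {}"
  shows "cols k A B \<noteq> {}"
proof -
  have "join A B (\<lambda>_. 1) (\<lambda>_. 2) \<in> cols k A B"
    using assms by (intro join_cols) (auto simp: compat_def)
  then show ?thesis by blast
qed

lemma diam_le_diam:
  assumes "diam_le k (Inl ` {..<p}) (Inr ` {..<q} :: (nat + nat) set) n"
  shows "diam k p q \<le> n" "diam_le k (Inl ` {..<p}) (Inr ` {..<q} :: (nat + nat) set) (diam k p q)"
  using assms unfolding diam_def by (auto intro: Least_le LeastI)

lemma diameter_eq_diam:
  assumes "complete_bipartite_digraph p q G" "0 < p" "p \<le> q" "3 \<le> k"
  shows "wf_digraph.diameter (with_proj (recolouring_graph k G)) = ereal (real (diam k p q))"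
proof -
  obtain A B where AB: "finite A" "finite B" "A \<inter> B = {}" "card A = p" "card B = q"
    and G: "recolouring_graph k G = \<lparr>pverts = cols k A B, parcs = steps k A B\<rparr>"
    using recolouring_graph_complete_bipartite[OF assms(1)] by metis
  have "A \<noteq> {}" using AB(4) assms(2) by auto
  \<comment> \<open>Any finite bound would do here; it only has to show that the
    \<open>LEAST\<close> exists.\<close>
  then have "diam_le k A B (2 * p + q + (q - p) div ((k + 1) div 2))"
    using upper_few[OF AB(1-3) _ assms(4)] AB(4,5) assms(3) by simp
  then have "diam_le k (Inl ` {..<p}) (Inr ` {..<q} :: (nat + nat) set) (diam k p q)"
    using diam_le_cong[OF AB(1,2) card_model(1,2) AB(3) card_model(3)] card_model(4,5) AB(4,5)
      diam_le_diam(2) by metis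
  then have upper: "diam_le k A B (diam k p q)"
    using diam_le_cong[OF AB(1,2) card_model(1,2) AB(3) card_model(3)] card_model(4,5) AB(4,5)
    by metis
  have lower: "\<not> diam_le k A B n" if "n < diam k p q" for n
    using diam_le_cong[OF AB(1,2) card_model(1,2) AB(3) card_model(3)] card_model(4,5) AB(4,5)
      diam_le_diam(1) that by (metis not_le)
  show ?thesis
    unfolding G
  proof (rule diameter_eqI)
    show "steps k A B \<subseteq> cols k A B \<times> cols k A B" unfolding steps_def by blast
    show "cols k A B \<noteq> {}" using cols_nonempty[of k A B] AB(3) assms(4) by simp
    show "\<exists>m\<le>diam k p q. (f, g) \<in> steps k A B ^^ m"
      if "f \<in> cols k A B" "g \<in> cols k A B" for f g
      using upper that unfolding diam_le_def reach_def by blast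
    show "\<exists>f\<in>cols k A B. \<exists>g\<in>cols k A B. \<forall>m\<le>n. (f, g) \<notin> steps k A B ^^ m"
      if "n < diam k p q" for n
      using lower[OF that] unfolding diam_le_def reach_def by blast
  qed
qed

lemma diam_many:
  assumes "0 < p" "p \<le> q" "3 \<le> k" "k * p \<le> q"
  shows "int (diam k p q) = 2 * int p + int q + int ((q - p) div (k - 1))"
proof -
  let ?A = "Inl ` {..<p} :: (nat + nat) set" and ?B = "Inr ` {..<q} :: (nat + nat) set"
  have "?A \<noteq> {}" using assms(1) by (auto simp: lessThan_empty_iff)
  then have "diam_le k ?A ?B (2 * p + q + (q - p) div (k - 1))"
    using upper_many[OF card_model(1-3), of p k q] card_model(4,5) assms by simp
  note diam = diam_le_diam[OF this]
  have "int (diam k p q) \<le> int (2 * p + q + (q - p) div (k - 1))"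
    using diam(1) by (simp only: of_nat_le_iff)
  then show ?thesis using lower_many[OF assms(1-3) diam(2)] by simp
qed

lemma diam_medium:
  assumes "0 < p" "p \<le> q" "3 \<le> k" "(k + 1) div 2 * p \<le> q" "q \<le> k * p"
  defines "m \<equiv> int (k div 2 * ((k + 1) div 2))"
  defines "r \<equiv> 3 * int p + int q + (int q - int k * int p) div m"
  shows "r - m \<le> int (diam k p q)" "int (diam k p q) \<le> r"
proof -
  let ?A = "Inl ` {..<p} :: (nat + nat) set" and ?B = "Inr ` {..<q} :: (nat + nat) set"
  have "?A \<noteq> {}" using assms(1) by (auto simp: lessThan_empty_iff)
  then obtain n where n: "diam_le k ?A ?B n" "int n = r"
    using upper_medium[OF card_model(1-3), of p k q] card_model(4,5) assms by auto
  show "int (diam k p q) \<le> r" using diam_le_diam(1)[OF n(1)] n(2) by simp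
  show "r - m \<le> int (diam k p q)"
    using lower_medium[OF assms(1-3) diam_le_diam(2)[OF n(1)] assms(4)] unfolding r_def m_def .
qed

lemma diam_few:
  assumes "0 < p" "p \<le> q" "3 \<le> k" "q \<le> (k + 1) div 2 * p"
  defines "r \<equiv> 2 * int p + int q + int ((q - p) div ((k + 1) div 2))"
  shows "r - int (k div 2) \<le> int (diam k p q)" "int (diam k p q) \<le> r"
proof -
  let ?A = "Inl ` {..<p} :: (nat + nat) set" and ?B = "Inr ` {..<q} :: (nat + nat) set"
  have "?A \<noteq> {}" using assms(1) by (auto simp: lessThan_empty_iff)
  then have n: "diam_le k ?A ?B (2 * p + q + (q - p) div ((k + 1) div 2))"
    using upper_few[OF card_model(1-3), of p k q] card_model(4,5) assms by simp
  have "int (diam k p q) \<le> int (2 * p + q + (q - p) div ((k + 1) div 2))"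
    using diam_le_diam(1)[OF n] by (simp only: of_nat_le_iff)
  then show "int (diam k p q) \<le> r" unfolding r_def by simp
  show "r - int (k div 2) \<le> int (diam k p q)"
    using lower_few[OF assms(1-3) diam_le_diam(2)[OF n] assms(4)] unfolding r_def .
qed

section \<open>Real floors and ceilings as integer division\<close>

lemma ceiling_half: "\<lceil>real k / 2\<rceil> = int ((k + 1) div 2)"
proof (cases "even k")
  case True
  then show ?thesis by (auto elim!: evenE)
next
  case False
  then obtain j where "k = 2 * j + 1" by (auto elim!: oddE)
  then show ?thesis by (simp add: ceiling_eq_iff)
qed

lemma floor_half: "\<lfloor>real k / 2\<rfloor> = int (k div 2)"
  using floor_divide_of_nat_eq[of k 2, where 'a = real] by simp

lemma floor_quarter_square: "\<lfloor>real k ^ 2 / 4\<rfloor> = int (k div 2 * ((k + 1) div 2))"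
proof -
  have "\<lfloor>real k ^ 2 / 4\<rfloor> = int (k ^ 2 div 4)"
    using floor_divide_of_nat_eq[of "k ^ 2" 4, where 'a = real] by simp
  also have "k ^ 2 div 4 = k div 2 * ((k + 1) div 2)"
  proof (cases "even k")
    case True
    then show ?thesis by (auto elim!: evenE simp: power2_eq_square)
  next
    case False
    then obtain j where k: "k = 2 * j + 1" by (auto elim!: oddE)
    have "k ^ 2 = 4 * (j * (j + 1)) + 1" unfolding k by (simp add: power2_eq_square algebra_simps)
    then have "k ^ 2 div 4 = j * (j + 1)" by simp
    then show ?thesis using k by simp
  qed
  finally show ?thesis .
qed

lemma floor_diff_divide:
  assumes "p \<le> q"
  shows "\<lfloor>(real q - real p) / real m\<rfloor> = int ((q - p) div m)"
  using floor_divide_of_nat_eq[of "q - p" m, where 'a = real] assms by (simp add: of_nat_diff)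

lemma floor_medium:
  "\<lfloor>(real q - real k * real p) / of_int m\<rfloor> = (int q - int k * int p) div m"
  using floor_divide_of_int_eq[of "int q - int k * int p" m, where 'a = real] by simp

theorem theorem1:
  shows "\<exists>g\<^sub>1 g\<^sub>2 :: nat \<Rightarrow> nat \<Rightarrow> nat \<Rightarrow> int.
    \<forall>(p :: nat) (q :: nat) (k :: nat) (G :: ('a, 'b) pre_digraph).
      0 < p \<longrightarrow> p \<le> q \<longrightarrow> 3 \<le> k \<longrightarrow> complete_bipartite_digraph p q G \<longrightarrow>
      0 \<le> g\<^sub>1 k p q \<and> g\<^sub>1 k p q \<le> \<lfloor>real k ^ 2 / 4\<rfloor> \<and>
      0 \<le> g\<^sub>2 k p q \<and> g\<^sub>2 k p q \<le> \<lfloor>real k / 2\<rfloor> \<and>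
      (k * p \<le> q \<longrightarrow>
        wf_digraph.diameter (with_proj (recolouring_graph k G)) =
          ereal (of_int (2 * int p + int q + \<lfloor>(real q - real p) / (real k - 1)\<rfloor>))) \<and>
      (\<lceil>real k / 2\<rceil> * int p \<le> int q \<and> q \<le> k * p \<longrightarrow>
        wf_digraph.diameter (with_proj (recolouring_graph k G)) =
          ereal (of_int (3 * int p + int q
            + \<lfloor>(real q - real k * real p) / of_int \<lfloor>real k ^ 2 / 4\<rfloor>\<rfloor> - g\<^sub>1 k p q))) \<and>
      (int q \<le> \<lceil>real k / 2\<rceil> * int p \<longrightarrow>
        wf_digraph.diameter (with_proj (recolouring_graph k G)) =
          ereal (of_int (2 * int p + int q
            + \<lfloor>(real q - real p) / of_int \<lceil>real k / 2\<rceil>\<rfloor> - g\<^sub>2 k p q)))"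
proof -
  \<comment> \<open>The corrections are the differences between main term and diameter, set to 0
    outside their range so that their bounds hold for all admissible parameters.\<close>
  define g1 where "g1 k p q = (if (k + 1) div 2 * p \<le> q \<and> q \<le> k * p
    then 3 * int p + int q + (int q - int k * int p) div int (k div 2 * ((k + 1) div 2)) - int (diam k p q)
    else 0)" for k p q
  define g2 where "g2 k p q = (if q \<le> (k + 1) div 2 * p
    then 2 * int p + int q + int ((q - p) div ((k + 1) div 2)) - int (diam k p q)
    else 0)" for k p q
  have ge: "\<lceil>real k / 2\<rceil> * int p \<le> int q \<longleftrightarrow> (k + 1) div 2 * p \<le> q" for k p q
    unfolding ceiling_half of_nat_mult[symmetric] of_nat_le_iff ..
  have le: "int q \<le> \<lceil>real k / 2\<rceil> * int p \<longleftrightarrow> q \<le> (k + 1) div 2 * p" for k p q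
    unfolding ceiling_half of_nat_mult[symmetric] of_nat_le_iff ..
  show ?thesis
  proof (rule exI[of _ g1], rule exI[of _ g2], intro allI impI)
    fix p q k :: nat and G :: "('a, 'b) pre_digraph"
    assume pqk: "0 < p" "p \<le> q" "3 \<le> k" and "complete_bipartite_digraph p q G"
    then have diameter: "wf_digraph.diameter (with_proj (recolouring_graph k G))
        = ereal (of_int (int (diam k p q)))"
      using diameter_eq_diam by simp
    have "0 \<le> g1 k p q \<and> g1 k p q \<le> \<lfloor>real k ^ 2 / 4\<rfloor>"
      unfolding floor_quarter_square g1_def using diam_medium[OF pqk] by auto
    moreover have "0 \<le> g2 k p q \<and> g2 k p q \<le> \<lfloor>real k / 2\<rfloor>"
      unfolding floor_half g2_def using diam_few[OF pqk] by auto
    moreover have "int (diam k p q) = 2 * int p + int q + \<lfloor>(real q - real p) / (real k - 1)\<rfloor>"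
      if "k * p \<le> q"
      using diam_many[OF pqk that] floor_diff_divide[OF pqk(2), of "k - 1"] pqk(3)
      by (simp add: of_nat_diff)
    moreover have "int (diam k p q) = 3 * int p + int q
        + \<lfloor>(real q - real k * real p) / of_int \<lfloor>real k ^ 2 / 4\<rfloor>\<rfloor> - g1 k p q"
      if "(k + 1) div 2 * p \<le> q" "q \<le> k * p"
      unfolding floor_medium floor_quarter_square g1_def using that by simp
    moreover have "int (diam k p q) = 2 * int p + int q
        + \<lfloor>(real q - real p) / of_int \<lceil>real k / 2\<rceil>\<rfloor> - g2 k p q"
      if "q \<le> (k + 1) div 2 * p"
      unfolding ceiling_half g2_def of_int_of_nat_eq floor_diff_divide[OF pqk(2)] using that by simp
    ultimately show "0 \<le> g1 k p q \<and> g1 k p q \<le> \<lfloor>real k ^ 2 / 4\<rfloor> \<and>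
      0 \<le> g2 k p q \<and> g2 k p q \<le> \<lfloor>real k / 2\<rfloor> \<and>
      (k * p \<le> q \<longrightarrow>
        wf_digraph.diameter (with_proj (recolouring_graph k G)) =
          ereal (of_int (2 * int p + int q + \<lfloor>(real q - real p) / (real k - 1)\<rfloor>))) \<and>
      (\<lceil>real k / 2\<rceil> * int p \<le> int q \<and> q \<le> k * p \<longrightarrow>
        wf_digraph.diameter (with_proj (recolouring_graph k G)) =
          ereal (of_int (3 * int p + int q
            + \<lfloor>(real q - real k * real p) / of_int \<lfloor>real k ^ 2 / 4\<rfloor>\<rfloor> - g1 k p q))) \<and>
      (int q \<le> \<lceil>real k / 2\<rceil> * int p \<longrightarrow>
        wf_digraph.diameter (with_proj (recolouring_graph k G)) =
          ereal (of_int (2 * int p + int q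
            + \<lfloor>(real q - real p) / of_int \<lceil>real k / 2\<rceil>\<rfloor> - g2 k p q)))"
      unfolding diameter ge le by simp
  qed
qed

end
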